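(* Consider the two-dimensional level set equations in the form of the system $$\partial_tu(t,\mathrm{x})+\partial_{x_1}f_1\big(u(t,\mathrm{x}),v(\mathrm{x})\big)+\partial_{x_2}f_2\big(u(t,\mathrm{x}),v(\mathrm{x})\big)=0,\quad f_1(u,v)=\begin{pmatrix} v\,\|u\|_2 \\ 0 \end{pmatrix},\quad f_2(u,v)=\begin{pmatrix} 0 \\ {v}\,\|u\|_2 \end{pmatrix},$$ for $u=(u_1,u_2)^T$ and $\mathrm{x}=(x_1,x_2)^T$. Assume a Haar-type expansion (see context) with gPC modes $\hat v$ that account for random velocities $v(\xi)$. Then a stochastic Galerkin formulation for these equations reads as $$\partial_t\hat u(t,\mathrm{x})+\partial_{x_1}\hat f_1\big(\hat u(t,\mathrm{x}),\hat v(\mathrm{x})\big)+\partial_{x_2}\hat f_2\big(\hat u(t,\mathrm{x}),\hat v(\mathrm{x})\big)=\vec 0$$ with flux functions $$\hat f_1(\hat u,\hat v)=\begin{pmatrix} \hat v\ast\widehat{\|u\|_2} \\ \vec 0 \end{pmatrix},\qquad \hat f_2(\hat u,\hat v)=\begin{pmatrix} \vec 0 \\ \hat v\ast\widehat{\|u\|_2} \end{pmatrix}.$$ For unit vectors $\vec n=(n_1,n_2)^T$ and $\vec n\cdot\mathrm{D}_{\hat u}\hat f:=n_1\mathrm{D}_{\hat u}\hat f_1+n_2\mathrm{D}_{\hat u}\hat f_2$, the real spectrum is $$\sigma\big\{\vec n\cdot\mathrm{D}_{\hat u}\hat f(\hat u,\hat v)\big\}=\Big\{\mathcal{D}(\hat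 v)\,\mathcal{D}\big(\widehat{\|u\|_2}\big)^{-1}\big(n_1\mathcal{D}(\hat u_1)+n_2\mathcal{D}(\hat u_2)\big),\ \mathbb{O}\Big\},$$ where the eigenvalues read as $$\mathcal{D}\big(\widehat{\|u\|_2}\big)=\sqrt{\mathcal{D}(\hat u_1)^2+\mathcal{D}(\hat u_2)^2}.$$ It is defined for all states $\hat u\in\mathbb{R}^{2(K+1)}$ and satisfies in the sense of generalized gradients the relation $$\sigma\big\{\vec n\cdot\mathrm{D}_{\hat u}\hat f(\hat u,\hat v)\big\}=\Big\{n_i\,\mathcal{D}(\hat v)\,\operatorname{sign}\{\mathcal{D}(\hat u_i)\},\ \mathbb{O}\Big\}\qquad\text{for}\quad \hat u_j=\vec 0\quad\text{with}\quad j\neq i.$$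
   Context: Haar-type expansion. Let $K\in\mathbb{N}_0$ and let $\xi\sim\mathcal{U}(0,1)$ be uniformly distributed, with law $\mathbb{P}$; write $\langle f,g\rangle_{\mathbb{P}}=\mathbb{E}[f(\xi)g(\xi)]$. Matrix and vector indices run over $0,\dots,K$. The canonical Haar matrix $A_c\in\mathbb{R}^{(K+1)\times(K+1)}$ has all entries equal to $1$ in row $0$; for $i=1,\dots,K$, row $i$ has zeros in columns $0,\dots,i-2$, the entry $h^d_i=s_ih^r_i$ in column $i-1$, and the entry $h^r_i=\sqrt{(K+1)/(s_i^2-s_i)}$ in columns $i,\dots,K$, where $s_i=-(K+1-i)$. A Haar-type matrix is $A=\begin{pmatrix}1&0\\0&O\end{pmatrix}A_c$ with an orthogonal matrix $O\in\mathbb{R}^{K\times K}$; it satisfies $AA^T=(K+1)I$. Its basis functions are $\phi_k(\xi)=\sum_{\ell=0}^K A_{k\ell}\,\chi_{[0,1]}((K+1)\xi-\ell)$, $k=0,\dots,K$, where $\chi_{[0,1]}$ is the indicator function of $[0,1]$; they are orthonormal in $L^2(\mathbb{P})$. Put $\mathcal{H}:=A/\sqrt{K+1}$, an orthogonal matrix. gPC modes $\hat w\in\mathbb{R}^{K+1}$ are the coefficients of a truncated expansion $\sum_{k=0}^K\hat w_k\phi_k(\xi)$ approximating a random quantity; the unknown is $\hat u=(\hat u_1,\hat u_2)^T$ with $\hat u_i\in\mathbb{R}^{K+1}$ the modes of $u_i$. The stochastic Galerkin matrix is $\mathcal{P}(\hat w)=\sum_{k=0}^K\hat w_k\mathcal{M}_k$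 with $\mathcal{M}_k=(\langle\phi_k,\phi_i\phi_j\rangle_{\mathbb{P}})_{i,j=0,\dots,K}$, and the Galerkin product (representing products of random quantities) is $\hat w\ast\hat q=\mathcal{P}(\hat w)\hat q$; $\hat e_1=(1,0,\dots,0)^T\in\mathbb{R}^{K+1}$. For Haar-type expansions $\mathcal{P}(\hat w)=\mathcal{H}\mathcal{D}(\hat w)\mathcal{H}^T$ with $\mathcal{D}(\hat w)$ a diagonal matrix of eigenvalues. The gPC modes of the Euclidean norm are $$\widehat{\|u\|_2}=\mathcal{H}\,\big|\mathcal{D}(\hat c(\hat u))\big|^{1/2}\,\mathcal{H}^T\hat e_1,\qquad \hat c(\hat u)=\sum_{i=1}^2\mathcal{H}\,|\mathcal{D}(\hat u_i)|^2\,\mathcal{H}^T\hat e_1 .$$ Functions (powers, absolute value, inverse, sign) of diagonal matrices are taken entrywise on the diagonal. $\mathrm{D}_{\hat u}$ denotes the Jacobian with respect to $\hat u$; derivatives of the norm are understood as generalized gradients. A spectrum written as a set of diagonal matrices means: the eigenvalues are the diagonal entries of these $(K+1)\times(K+1)$ matrices; $\mathbb{O}$ is the zero matrix.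
   Formalization: Where D(û_i) has zero entries, the last relation (û_j = 0) is proved for limits of Jacobians along states with û_j = 0, sign(0) read as [-1,1], and for some element of the full generalized Jacobian with sign(0) = 0; for the full one equality fails, e.g. û = 0, |n_i| < 1. *)

theory Defs
  imports "HOL-Analysis.Analysis" "HOL-Computational_Algebra.Polynomial"
begin

type_synonym 'k rvec = "(real, 'k) vec"
type_synonym 'k sqmat = "((real, 'k) vec, 'k) vec"

text \<open>The index set \<open>{0,\<dots>,K}\<close> is an arbitrary finite linearly ordered type, so \<open>K + 1\<close> is its
  cardinality and every \<open>K \<ge> 0\<close> occurs; the function \<open>pos\<close> below recovers the number of an index.\<close>

definition pos :: "'k::{finite,linorder} \<Rightarrow> nat" where
  "pos i = card {j. j < i}"

section \<open>Haar-type matrices and their basis functions\<close>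

definition haar_s :: "'k::{finite,linorder} \<Rightarrow> real" where
  "haar_s i = - (real CARD('k) - real (pos i))"

definition haar_hr :: "'k::{finite,linorder} \<Rightarrow> real" where
  "haar_hr i = sqrt (real CARD('k) / ((haar_s i)\<^sup>2 - haar_s i))"

definition haar_hd :: "'k::{finite,linorder} \<Rightarrow> real" where
  "haar_hd i = haar_s i * haar_hr i"

definition haar_canonical :: "'k::{finite,linorder} sqmat" where
  "haar_canonical = (\<chi> i j.
     if pos i = 0 then 1
     else if pos j + 1 < pos i then 0
     else if pos j + 1 = pos i then haar_hd i
     else haar_hr i)"

text \<open>The matrix \<open>block_one Q\<close> is block diagonal with blocks \<open>1\<close> and the lower right
  \<open>K \<times> K\<close> part of \<open>Q\<close>; the remaining entries of \<open>Q\<close> are ignored.  It is orthogonal iff the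
  \<open>K \<times> K\<close> block is.\<close>

definition block_one :: "'k::{finite,linorder} sqmat \<Rightarrow> 'k sqmat" where
  "block_one Q = (\<chi> i j.
     if pos i = 0 \<and> pos j = 0 then 1
     else if pos i = 0 \<or> pos j = 0 then 0
     else Q $ i $ j)"

definition haar_type :: "'k::{finite,linorder} sqmat \<Rightarrow> bool" where
  "haar_type A \<longleftrightarrow> (\<exists>Q. orthogonal_matrix (block_one Q) \<and> A = block_one Q ** haar_canonical)"

definition haar_basis :: "'k::{finite,linorder} sqmat \<Rightarrow> 'k \<Rightarrow> real \<Rightarrow> real" where
  "haar_basis A k \<xi> =
     (\<Sum>l\<in>UNIV. A $ k $ l * indicator {0..1} (real CARD('k) * \<xi> - real (pos l)))"

definition inner_P :: "(real \<Rightarrow> real) \<Rightarrow> (real \<Rightarrow> real) \<Rightarrow> real" where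
  "inner_P f g = (LINT \<xi>|uniform_measure lborel {0..1}. f \<xi> * g \<xi>)"

definition haar_orth :: "'k::{finite,linorder} sqmat \<Rightarrow> 'k sqmat" where
  "haar_orth A = (1 / sqrt (real CARD('k))) *\<^sub>R A"

section \<open>Galerkin product and eigenvalues\<close>

definition galerkin_tensor :: "'k::{finite,linorder} sqmat \<Rightarrow> 'k \<Rightarrow> 'k sqmat" where
  "galerkin_tensor A k =
     (\<chi> i j. inner_P (haar_basis A k) (\<lambda>\<xi>. haar_basis A i \<xi> * haar_basis A j \<xi>))"

definition galerkin_matrix :: "'k::{finite,linorder} sqmat \<Rightarrow> 'k rvec \<Rightarrow> 'k sqmat" where
  "galerkin_matrix A w = (\<Sum>k\<in>UNIV. w $ k *\<^sub>R galerkin_tensor A k)"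

definition galerkin_prod ::
  "'k::{finite,linorder} sqmat \<Rightarrow> 'k rvec \<Rightarrow> 'k rvec \<Rightarrow> 'k rvec" where
  "galerkin_prod A w q = galerkin_matrix A w *v q"

text \<open>For Haar-type \<open>A\<close> the matrix \<open>eigmat A w\<close> is the diagonal matrix in the decomposition
  \<open>P(w) = H D(w) H\<^sup>T\<close>, see \<open>diagonal_eigmat\<close> and \<open>galerkin_matrix_eigmat\<close> below.\<close>

definition eigmat ::
  "'k::{finite,linorder} sqmat \<Rightarrow> 'k rvec \<Rightarrow> 'k sqmat" where
  "eigmat A w = transpose (haar_orth A) ** galerkin_matrix A w ** haar_orth A"

definition diag_mat :: "('k \<Rightarrow> real) \<Rightarrow> real ^ 'k ^ 'k" where
  "diag_mat d = (\<chi> i j. if i = j then d i else 0)"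

definition diag_map :: "(real \<Rightarrow> real) \<Rightarrow> real ^ 'k ^ 'k \<Rightarrow> real ^ 'k ^ 'k" where
  "diag_map f D = diag_mat (\<lambda>l. f (D $ l $ l))"

section \<open>Level set fluxes and their Galerkin projection\<close>

text \<open>The gPC state has the index type \<open>2 \<times> 'k\<close>; the first index selects the component
  (\<open>1\<close> or \<open>2\<close>) of the random vector.\<close>

definition modes :: "real ^ (2 \<times> 'k) \<Rightarrow> 2 \<Rightarrow> real ^ 'k" where
  "modes u i = (\<chi> k. u $ (i, k))"

definition ehat1 :: "'k::{finite,linorder} rvec" where
  "ehat1 = (\<chi> k. if pos k = 0 then 1 else 0)"

definition norm_sq_modes ::
  "'k::{finite,linorder} sqmat \<Rightarrow> real ^ (2 \<times> 'k) \<Rightarrow> 'k rvec" where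
  "norm_sq_modes A u = (\<Sum>i\<in>UNIV.
     (haar_orth A ** diag_map (\<lambda>x. \<bar>x\<bar>\<^sup>2) (eigmat A (modes u i)) ** transpose (haar_orth A)) *v ehat1)"

definition norm_modes ::
  "'k::{finite,linorder} sqmat \<Rightarrow> real ^ (2 \<times> 'k) \<Rightarrow> 'k rvec" where
  "norm_modes A u =
     (haar_orth A ** diag_map (\<lambda>x. sqrt \<bar>x\<bar>) (eigmat A (norm_sq_modes A u))
        ** transpose (haar_orth A)) *v ehat1"

definition level_set_flux :: "2 \<Rightarrow> real ^ 2 \<Rightarrow> real \<Rightarrow> real ^ 2" where
  "level_set_flux d u v = (\<chi> i. if i = d then v * norm u else 0)"

definition gpc_flux ::
  "'k::{finite,linorder} sqmat \<Rightarrow> 2 \<Rightarrow> real ^ (2 \<times> 'k) \<Rightarrow> 'k rvec \<Rightarrow> real ^ (2 \<times> 'k)" where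
  "gpc_flux A d u v =
     (\<chi> p. if fst p = d then galerkin_prod A v (norm_modes A u) $ snd p else 0)"

definition expansion ::
  "'k::{finite,linorder} sqmat \<Rightarrow> 'k rvec \<Rightarrow> real \<Rightarrow> real" where
  "expansion A w \<xi> = (\<Sum>k\<in>UNIV. w $ k * haar_basis A k \<xi>)"

definition expansion2 ::
  "'k::{finite,linorder} sqmat \<Rightarrow> real ^ (2 \<times> 'k) \<Rightarrow> real \<Rightarrow> real ^ 2" where
  "expansion2 A u \<xi> = (\<chi> i. expansion A (modes u i) \<xi>)"

definition galerkin_projection ::
  "'k::{finite,linorder} sqmat \<Rightarrow> (real \<Rightarrow> real ^ 2) \<Rightarrow> real ^ (2 \<times> 'k)" where
  "galerkin_projection A q = (\<chi> p. inner_P (\<lambda>\<xi>. q \<xi> $ fst p) (haar_basis A (snd p)))"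

text \<open>The equation \<open>\<partial>\<^sub>t U + \<partial>\<^bsub>x\<^sub>1\<^esub> F\<^sub>1 + \<partial>\<^bsub>x\<^sub>2\<^esub> F\<^sub>2 = 0\<close> holds classically at the point \<open>(t, x)\<close>, where
  \<open>F d\<close> is the flux in direction \<open>d\<close>, evaluated along the solution.\<close>

definition conservation_law_at ::
  "(real \<Rightarrow> real ^ 2 \<Rightarrow> 'v::real_normed_vector) \<Rightarrow> (2 \<Rightarrow> real \<Rightarrow> real ^ 2 \<Rightarrow> 'v)
     \<Rightarrow> real \<Rightarrow> real ^ 2 \<Rightarrow> bool" where
  "conservation_law_at U F t x \<longleftrightarrow> (\<exists>Ut Fx1 Fx2.
     ((\<lambda>s. U s x) has_vector_derivative Ut) (at t) \<and>
     ((\<lambda>s. F 1 t (x + s *\<^sub>R axis 1 1)) has_vector_derivative Fx1) (at 0) \<and>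
     ((\<lambda>s. F 2 t (x + s *\<^sub>R axis 2 1)) has_vector_derivative Fx2) (at 0) \<and>
     Ut + Fx1 + Fx2 = 0)"

section \<open>Spectra\<close>

definition char_poly :: "real ^ 'n ^ 'n \<Rightarrow> real poly" where
  "char_poly M = det (\<chi> i j. (if i = j then [:0, 1:] else 0) - [:M $ i $ j:])"

definition complex_spectrum :: "real ^ 'n ^ 'n \<Rightarrow> complex set" where
  "complex_spectrum M =
     {\<mu>. \<exists>z. z \<noteq> 0 \<and> (\<chi> i j. complex_of_real (M $ i $ j)) *v z = \<mu> *s z}"

text \<open>The eigenvalues of \<open>M\<close> over the complex numbers are the diagonal entries of the listed
  matrices; in particular the spectrum is real.  The second conjunct adds that each of them is
  listed as often as its algebraic multiplicity.\<close>

definition has_spectrum :: "real ^ 'n ^ 'n \<Rightarrow> (real ^ 'k ^ 'k) list \<Rightarrow> bool" where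
  "has_spectrum M Ds \<longleftrightarrow>
     complex_spectrum M = complex_of_real ` (\<Union>D\<in>set Ds. range (\<lambda>l. D $ l $ l)) \<and>
     char_poly M = prod_list (map (\<lambda>D. \<Prod>l\<in>UNIV. [:- (D $ l $ l), 1:]) Ds)"

section \<open>Generalized gradients\<close>

text \<open>Clarke's generalized Jacobian is the case \<open>S = UNIV\<close>.  In general, only those limits of
  classical (full) Jacobians are admitted that are attained along sequences in \<open>S\<close>.\<close>

definition generalized_jacobian ::
  "(real ^ 'n) set \<Rightarrow> (real ^ 'n \<Rightarrow> real ^ 'm) \<Rightarrow> real ^ 'n \<Rightarrow> (real ^ 'n ^ 'm) set" where
  "generalized_jacobian S F u = convex hull
     {M. \<exists>X. (\<forall>m. X m \<in> S \<and> F differentiable at (X m)) \<and> X \<longlonglongrightarrow> u \<and>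
             (\<lambda>m. jacobian F (at (X m))) \<longlonglongrightarrow> M}"

text \<open>The generalized gradient of the norm of a Euclidean space: the singleton of
  \<open>y / norm y\<close> away from zero and the closed unit ball at zero.  On the reals this is the
  set-valued sign, with value \<open>[-1, 1]\<close> at zero.\<close>

definition generalized_sgn :: "'a::real_normed_vector \<Rightarrow> 'a set" where
  "generalized_sgn y = (if y = 0 then cball 0 1 else {sgn y})"

section \<open>Diagonalization of the stochastic Galerkin matrix\<close>

lemma pos_less: "pos i < CARD('k)" for i :: "'k::{finite,linorder}"
  unfolding pos_def by (rule psubset_card_mono) auto

lemma pos_strict_mono: "i < j \<Longrightarrow> pos i < pos j" for i j :: "'k::{finite,linorder}"
  unfolding pos_def by (rule psubset_card_mono) auto

lemma pos_eq_iff [simp]: "pos i = pos j \<longleftrightarrow> i = j" for i j :: "'k::{finite,linorder}"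
  by (metis linorder_neqE nless_le pos_strict_mono)

lemma bij_betw_pos: "bij_betw pos (UNIV :: 'k::{finite,linorder} set) {..<CARD('k)}"
proof -
  have inj: "inj (pos :: 'k \<Rightarrow> nat)" by (auto simp: inj_def)
  have "pos ` (UNIV :: 'k set) = {..<CARD('k)}"
    by (rule card_subset_eq) (auto simp: pos_less card_image[OF inj])
  with inj show ?thesis by (simp add: bij_betw_def)
qed

lemma sum_pos:
  fixes f :: "nat \<Rightarrow> 'a::comm_monoid_add"
  shows "(\<Sum>j\<in>(UNIV :: 'k::{finite,linorder} set). f (pos j)) = (\<Sum>m<CARD('k). f m)"
  by (rule sum.reindex_bij_betw[OF bij_betw_pos])

lemma haar_hr_sq:
  fixes i :: "'k::{finite,linorder}"
  assumes "pos i \<noteq> 0"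
  shows "haar_s i \<le> -1" "(haar_hr i)\<^sup>2 * ((haar_s i)\<^sup>2 - haar_s i) = real CARD('k)"
proof -
  have "real (pos i) + 1 \<le> real CARD('k)" using pos_less[of i] by linarith
  thus 1: "haar_s i \<le> -1" by (simp add: haar_s_def)
  have "(haar_s i)\<^sup>2 - haar_s i > 0" using 1 by (smt (verit) zero_le_power2)
  thus "(haar_hr i)\<^sup>2 * ((haar_s i)\<^sup>2 - haar_s i) = real CARD('k)"
    by (simp add: haar_hr_def)
qed

lemma row_sum:
  fixes c d :: real
  assumes "0 < p" "p < n"
  shows "(\<Sum>m<n. if m + 1 < p then 0 else if m + 1 = p then c else d) = c + real (n - p) * d"
proof -
  have "(\<Sum>m<n. if m + 1 < p then 0 else if m + 1 = p then c else d)
      = (\<Sum>m\<in>insert (p - 1) {p..<n}. if m + 1 < p then 0 else if m + 1 = p then c else d)"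
    using assms by (intro sum.mono_neutral_right) auto
  also have "\<dots> = c + (\<Sum>m=p..<n. d)"
    using assms by (subst sum.insert) (auto intro!: arg_cong2[of _ _ _ _ "(+)"] sum.cong)
  finally show ?thesis by simp
qed

lemma row_sum_pos:
  fixes c d :: real and i :: "'k::{finite,linorder}"
  assumes "0 < pos i"
  shows "(\<Sum>j\<in>(UNIV::'k set). if pos j + 1 < pos i then 0 else if pos j + 1 = pos i then c else d)
    = c + real (CARD('k) - pos i) * d"
  using row_sum[OF assms pos_less, of c d]
    sum_pos[where 'k = 'k and f = "\<lambda>m. if m + 1 < pos i then 0 else if m + 1 = pos i then c else d"] by simp

lemma haar_canonical_orthogonal:
  "haar_canonical ** transpose haar_canonical
     = (real CARD('k) *\<^sub>R mat 1 :: 'k::{finite,linorder} sqmat)"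
proof -
  let ?C = "haar_canonical :: 'k sqmat"
  have off: "(\<Sum>j\<in>UNIV. ?C $ i $ j * ?C $ i' $ j) = 0" if "pos i < pos i'" for i i'
  proof -
    define c where "c = (if pos i = 0 then 1 else haar_hr i)"
    have "(\<Sum>j\<in>UNIV. ?C $ i $ j * ?C $ i' $ j)
        = (\<Sum>j\<in>(UNIV::'k set). if pos j + 1 < pos i' then 0 else if pos j + 1 = pos i'
              then c * haar_hd i' else c * haar_hr i')"
      using that by (intro sum.cong) (auto simp: haar_canonical_def c_def)
    also have "\<dots> = c * haar_hd i' + real (CARD('k) - pos i') * (c * haar_hr i')"
      using that by (intro row_sum_pos) auto
    also have "\<dots> = 0"
      using pos_less[of i'] by (simp add: haar_hd_def haar_s_def of_nat_diff algebra_simps)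
    finally show ?thesis .
  qed
  have diag: "(\<Sum>j\<in>UNIV. ?C $ i $ j * ?C $ i $ j) = real CARD('k)" for i
  proof (cases "pos i = 0")
    case True
    thus ?thesis by (simp add: haar_canonical_def)
  next
    case False
    have "(\<Sum>j\<in>UNIV. ?C $ i $ j * ?C $ i $ j)
        = (\<Sum>j\<in>(UNIV::'k set). if pos j + 1 < pos i then 0 else if pos j + 1 = pos i
              then haar_hd i * haar_hd i else haar_hr i * haar_hr i)"
      using False by (intro sum.cong) (auto simp: haar_canonical_def)
    also have "\<dots> = haar_hd i * haar_hd i + real (CARD('k) - pos i) * (haar_hr i * haar_hr i)"
      using False by (intro row_sum_pos) auto
    also have "\<dots> = (haar_hr i)\<^sup>2 * ((haar_s i)\<^sup>2 - haar_s i)"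
      using pos_less[of i]
      by (simp add: haar_hd_def haar_s_def of_nat_diff power2_eq_square algebra_simps)
    finally show ?thesis using haar_hr_sq(2)[OF False] by simp
  qed
  have "(\<Sum>j\<in>UNIV. ?C $ i $ j * ?C $ i' $ j) = (if i = i' then real CARD('k) else 0)" for i i'
  proof -
    consider "i = i'" | "pos i < pos i'" | "pos i' < pos i"
      by (metis linorder_neqE_nat pos_eq_iff)
    thus ?thesis using off[of i i'] off[of i' i] diag[of i] by cases (auto simp: mult.commute)
  qed
  thus ?thesis
    by (auto simp: vec_eq_iff matrix_matrix_mult_def transpose_def mat_def)
qed

lemma haar_type_orthogonal:
  fixes A :: "'k::{finite,linorder} sqmat"
  assumes "haar_type A"
  shows "A ** transpose A = real CARD('k) *\<^sub>R mat 1" "orthogonal_matrix (haar_orth A)"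
proof -
  obtain Q where Q: "orthogonal_matrix (block_one Q)" "A = block_one Q ** haar_canonical"
    using assms by (auto simp: haar_type_def)
  have "A ** transpose A
      = block_one Q ** (haar_canonical ** transpose haar_canonical) ** transpose (block_one Q)"
    by (simp add: Q(2) matrix_transpose_mul matrix_mul_assoc)
  also have "\<dots> = real CARD('k) *\<^sub>R (block_one Q ** transpose (block_one Q))"
    by (simp add: haar_canonical_orthogonal matrix_scalar_ac scalar_matrix_assoc)
  finally show 1: "A ** transpose A = real CARD('k) *\<^sub>R mat 1"
    using Q(1) by (simp add: orthogonal_matrix_def)
  have "haar_orth A ** transpose (haar_orth A)
      = (1 / sqrt (real CARD('k)) * (1 / sqrt (real CARD('k)))) *\<^sub>R (A ** transpose A)"
    by (simp add: haar_orth_def vec_eq_iff matrix_matrix_mult_def transpose_def sum_distrib_left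
        mult_ac)
  also have "\<dots> = mat 1" using 1 by simp
  finally have "haar_orth A ** transpose (haar_orth A) = mat 1" .
  moreover from this have "transpose (haar_orth A) ** haar_orth A = mat 1"
    by (simp add: matrix_left_right_inverse)
  ultimately show "orthogonal_matrix (haar_orth A)" by (simp add: orthogonal_matrix_def)
qed

lemma galerkin_matrix_eigmat:
  assumes "haar_type A"
  shows "galerkin_matrix A w = haar_orth A ** eigmat A w ** transpose (haar_orth A)"
proof -
  have "haar_orth A ** eigmat A w ** transpose (haar_orth A)
    = (haar_orth A ** transpose (haar_orth A)) ** galerkin_matrix A w
        ** (haar_orth A ** transpose (haar_orth A))"
    by (simp add: eigmat_def matrix_mul_assoc)
  thus ?thesis using haar_type_orthogonal(2)[OF assms] by (simp add: orthogonal_matrix_def)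
qed

lemma inner_P_cells:
  fixes l m n :: "'k::{finite,linorder}"
  defines "I \<equiv> \<lambda>(l::'k) \<xi>. indicator {0..1} (real CARD('k) * \<xi> - real (pos l)) :: real"
  shows "has_bochner_integral (uniform_measure lborel {0..1}) (\<lambda>\<xi>. I l \<xi> * (I m \<xi> * I n \<xi>))
           (if l = m \<and> l = n then 1 / real CARD('k) else 0)"
proof -
  let ?N = "real CARD('k)"
  have N: "?N > 0" by simp
  define S where "S = (\<lambda>l::'k. {real (pos l) / ?N .. (real (pos l) + 1) / ?N})"
  have I: "I l \<xi> = indicator (S l) \<xi>" for l \<xi>
    using N by (auto simp: I_def S_def indicator_def field_simps)
  have sub: "S l \<subseteq> {0..1}" for l
  proof -
    have "real (pos l) + 1 \<le> ?N" using pos_less[of l] by linarith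
    thus ?thesis using N by (auto simp: S_def field_simps)
  qed
  have Ssets: "S a \<in> sets lborel" for a by (simp add: S_def)
  let ?T = "S l \<inter> S m \<inter> S n"
  have T: "?T \<in> sets lborel" by (simp add: S_def)
  have emu: "emeasure (uniform_measure lborel {0..1::real}) ?T = emeasure lborel ?T"
    using sub[of l] T by (subst emeasure_uniform_measure) (auto simp: Int_absorb1 le_infI1 divide_ennreal_def)
  have eS: "emeasure lborel (S l) = ennreal (1 / ?N)"
    using N by (simp add: S_def divide_right_mono diff_divide_distrib[symmetric])
  have val: "emeasure lborel ?T = ennreal (if l = m \<and> l = n then 1 / ?N else 0)"
  proof (cases "l = m \<and> l = n")
    case True thus ?thesis using eS by auto
  next
    case False
    have two: "emeasure lborel (S a \<inter> S b) = 0" if "pos a < pos b" for a b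
    proof -
      have "real (pos a) + 1 \<le> real (pos b)" using that by linarith
      hence "(real (pos a) + 1) / ?N \<le> real (pos b) / ?N" using N by (simp add: divide_right_mono)
      hence "S a \<inter> S b \<subseteq> {real (pos b) / ?N}" by (auto simp: S_def)
      thus ?thesis by (metis emeasure_lborel_countable countable_subset countable_empty countable_insert)
    qed
    have two': "emeasure lborel (S a \<inter> S b) = 0" if "a \<noteq> b" for a b
      using two[of a b] two[of b a] that by (metis Int_commute linorder_neqE_nat pos_eq_iff)
    have "emeasure lborel ?T \<le> 0"
    proof (cases "l = m")
      case True
      with False have "emeasure lborel (S l \<inter> S n) = 0" using two' by auto
      thus ?thesis using emeasure_mono[of ?T "S l \<inter> S n" lborel] Ssets[of l] Ssets[of n]
        by (metis inf.coboundedI1 inf_le1 inf_le2 le_inf_iff sets.Int)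
    next
      case False
      hence "emeasure lborel (S l \<inter> S m) = 0" using two' by auto
      thus ?thesis using emeasure_mono[of ?T "S l \<inter> S m" lborel] Ssets[of l] Ssets[of m]
        by (metis inf_le1 sets.Int)
    qed
    thus ?thesis using False by simp
  qed
  have "has_bochner_integral (uniform_measure lborel {0..1}) (\<lambda>\<xi>. indicator ?T \<xi> :: real)
          (measure (uniform_measure lborel {0..1}) ?T)"
    using T emu val by (intro has_bochner_integral_real_indicator) (auto simp: less_top[symmetric])
  moreover have "measure (uniform_measure lborel {0..1::real}) ?T
      = (if l = m \<and> l = n then 1 / ?N else 0)"
    using emu val N by (simp add: measure_def)
  moreover have "(\<lambda>\<xi>. I l \<xi> * (I m \<xi> * I n \<xi>)) = (\<lambda>\<xi>. indicator ?T \<xi> :: real)"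
    by (auto simp: I indicator_def fun_eq_iff)
  ultimately show ?thesis by simp
qed

lemma galerkin_tensor_entry:
  fixes A :: "'k::{finite,linorder} sqmat"
  shows "galerkin_tensor A k $ i $ j
    = (\<Sum>l\<in>UNIV. A $ k $ l * A $ i $ l * A $ j $ l) / real CARD('k)"
proof -
  define I where "I = (\<lambda>(l::'k) \<xi>. indicator {0..1} (real CARD('k) * \<xi> - real (pos l)) :: real)"
  have eq: "haar_basis A k \<xi> * (haar_basis A i \<xi> * haar_basis A j \<xi>)
     = (\<Sum>l\<in>UNIV. \<Sum>m\<in>UNIV. \<Sum>n\<in>UNIV. (A $ k $ l * A $ i $ m * A $ j $ n)
            * (I l \<xi> * (I m \<xi> * I n \<xi>)))" for \<xi>
    proof -
    have "haar_basis A k' \<xi> = (\<Sum>l\<in>UNIV. A $ k' $ l * I l \<xi>)" for k'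
      by (simp only: haar_basis_def I_def)
    thus ?thesis by (simp only: sum_product) (simp add: sum_distrib_left mult_ac)
  qed
  have "has_bochner_integral (uniform_measure lborel {0..1})
     (\<lambda>\<xi>. haar_basis A k \<xi> * (haar_basis A i \<xi> * haar_basis A j \<xi>))
     (\<Sum>l\<in>UNIV. \<Sum>m\<in>UNIV. \<Sum>n\<in>UNIV. (A $ k $ l * A $ i $ m * A $ j $ n)
            * (if l = m \<and> l = n then 1 / real CARD('k) else 0))"
    unfolding eq I_def
    by (intro has_bochner_integral_sum has_bochner_integral_mult_right inner_P_cells)
  also have "(\<Sum>l\<in>UNIV. \<Sum>m\<in>UNIV. \<Sum>n\<in>UNIV. (A $ k $ l * A $ i $ m * A $ j $ n)
            * (if l = m \<and> l = n then 1 / real CARD('k) else 0))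
     = (\<Sum>l\<in>UNIV. \<Sum>m\<in>UNIV. if l = m then
          (A $ k $ l * A $ i $ m * A $ j $ l) / real CARD('k) else 0)"
    by (intro sum.cong refl) (auto simp: if_distrib cong: if_cong)
  also have "\<dots> = (\<Sum>l\<in>UNIV. A $ k $ l * A $ i $ l * A $ j $ l) / real CARD('k)"
    by (simp add: sum_divide_distrib)
  finally show ?thesis
    by (simp add: galerkin_tensor_def inner_P_def has_bochner_integral_integral_eq)
qed

lemma eigmat_eq:
  fixes A :: "'k::{finite,linorder} sqmat"
  assumes "haar_type A"
  shows "eigmat A w = diag_mat (\<lambda>l. \<Sum>k\<in>UNIV. w $ k * A $ k $ l)"
proof -
  let ?H = "haar_orth A" and ?d = "\<lambda>l. \<Sum>k\<in>UNIV. w $ k * A $ k $ l"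
  have "galerkin_matrix A w $ i $ j = (?H ** diag_mat ?d ** transpose ?H) $ i $ j" for i j
  proof -
    have "galerkin_matrix A w $ i $ j
       = (\<Sum>k\<in>UNIV. \<Sum>l\<in>UNIV. w $ k * A $ k $ l * A $ i $ l * A $ j $ l / real CARD('k))"
      by (simp add: galerkin_matrix_def galerkin_tensor_entry sum_divide_distrib sum_distrib_left
          mult.assoc)
    also have "\<dots> = (\<Sum>l\<in>UNIV. \<Sum>k\<in>UNIV. w $ k * A $ k $ l * A $ i $ l * A $ j $ l / real CARD('k))"
      by (rule sum.swap)
    also have "\<dots> = (\<Sum>l\<in>UNIV. ?H $ i $ l * ?d l * ?H $ j $ l)"
      by (intro sum.cong refl)
        (simp add: haar_orth_def sum_distrib_left sum_distrib_right sum_divide_distrib mult_ac)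
    also have "\<dots> = (?H ** diag_mat ?d ** transpose ?H) $ i $ j"
      by (simp add: matrix_matrix_mult_def transpose_def diag_mat_def if_distrib cong: if_cong)
    finally show ?thesis .
  qed
  hence "galerkin_matrix A w = ?H ** diag_mat ?d ** transpose ?H" by (simp add: vec_eq_iff)
  hence "eigmat A w = (transpose ?H ** ?H) ** diag_mat ?d ** (transpose ?H ** ?H)"
    by (simp add: eigmat_def matrix_mul_assoc)
  thus ?thesis using haar_type_orthogonal(2)[OF assms] by (simp add: orthogonal_matrix_def)
qed

lemma diagonal_eigmat:
  assumes "haar_type A" "i \<noteq> j"
  shows "eigmat A w $ i $ j = 0"
  using assms by (simp add: eigmat_eq diag_mat_def)

end

theory Submission
  imports Defs
begin

text \<open>Haar-type basis functions are constant on the \<open>K + 1\<close> cells, so in the cell values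
  \<open>D(w)\<close> every Galerkin operation acts cell by cell.  If \<open>y\<^sub>l \<in> \<real>\<^sup>2\<close> is the value of \<open>u\<close> and \<open>c\<^sub>l\<close>
  that of \<open>v\<close> in cell \<open>l\<close>, the flux in direction \<open>n\<close> has the cell values \<open>c\<^sub>l |y\<^sub>l| n\<close>.  Its
  derivative decouples into the \<open>2 \<times> 2\<close> blocks \<open>c\<^sub>l n G\<^sub>l\<^sup>T\<close> with \<open>G\<^sub>l = y\<^sub>l / |y\<^sub>l|\<close>, whose
  eigenvalues are \<open>c\<^sub>l n \<bullet> G\<^sub>l\<close> and \<open>0\<close>.  The flux is not differentiable where \<open>y\<^sub>l = 0 \<noteq> c\<^sub>l\<close>; there
  the limits of Jacobians realize every unit vector as \<open>G\<^sub>l\<close>, independently in each cell, and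
  convexification fills the unit ball.\<close>

section \<open>Cell values\<close>

text \<open>Column \<open>l\<close> of \<open>A\<close> lists the values of the basis functions
  inside cell \<open>l\<close>, so this is the value of the expansion there and also the entry
  \<open>l\<close> of \<open>D(w)\<close>.\<close>

definition cell_value :: "'k::{finite,linorder} sqmat \<Rightarrow> 'k rvec \<Rightarrow> 'k \<Rightarrow> real" where
  "cell_value A w l = (\<Sum>k\<in>UNIV. w $ k * A $ k $ l)"

text \<open>As \<open>A\<close> times its transpose is \<open>K + 1\<close> times the identity,
  \<open>A / (K + 1)\<close> inverts \<open>cell_value\<close>. The factor
  \<open>1 / (K + 1)\<close> is also the length of a cell.\<close>

definition cell_modes :: "'k::{finite,linorder} sqmat \<Rightarrow> ('k \<Rightarrow> real) \<Rightarrow> 'k rvec" where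
  "cell_modes A d = (\<chi> k. (\<Sum>l\<in>UNIV. A $ k $ l * d l) / real CARD('k))"

text \<open>The leading block 1 keeps the constant row of the canonical matrix, so
  \<open>ehat1\<close> holds the modes of the constant function 1.\<close>

lemma haar_type_first_row:
  assumes "haar_type A" "pos k = 0"
  shows "A $ k $ l = 1"
proof -
  obtain Q where Q: "A = block_one Q ** haar_canonical"
    using assms(1) by (auto simp: haar_type_def)
  have "A $ k $ l = (\<Sum>m\<in>UNIV. if m = k then 1 else 0)"
    unfolding Q matrix_matrix_mult_def vec_lambda_beta
  proof (rule sum.cong[OF refl])
    show "block_one Q $ k $ m * haar_canonical $ m $ l = (if m = k then 1 else 0)" for m
      using assms(2) pos_eq_iff[of m k] by (auto simp: block_one_def haar_canonical_def)
  qed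
  thus ?thesis by simp
qed

lemma haar_type_rows:
  fixes A :: "'k::{finite,linorder} sqmat"
  assumes "haar_type A"
  shows "(\<Sum>l\<in>UNIV. A $ i $ l * A $ j $ l) = (if i = j then real CARD('k) else 0)"
  using arg_cong[OF haar_type_orthogonal(1)[OF assms], of "\<lambda>M. M $ i $ j"]
  by (simp add: matrix_matrix_mult_def transpose_def mat_def)

text \<open>A right inverse of a square matrix is also a left inverse, which carries orthogonality
  over from rows to columns.\<close>

lemma haar_type_columns:
  fixes A :: "'k::{finite,linorder} sqmat"
  assumes "haar_type A"
  shows "(\<Sum>k\<in>UNIV. A $ k $ l * A $ k $ m) = (if l = m then real CARD('k) else 0)"
proof -
  have "A ** ((1 / real CARD('k)) *\<^sub>R transpose A) = mat 1"
    by (simp add: matrix_scalar_ac haar_type_orthogonal(1)[OF assms] flip: scalar_matrix_assoc)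
  hence "((1 / real CARD('k)) *\<^sub>R transpose A) ** A = mat 1"
    by (simp only: matrix_left_right_inverse)
  from arg_cong[OF this, of "\<lambda>M. M $ l $ m"] show ?thesis
    by (simp add: matrix_matrix_mult_def transpose_def mat_def field_simps flip: sum_divide_distrib split: if_splits)
qed

lemma eigmat_cell_value: "haar_type A \<Longrightarrow> eigmat A w = diag_mat (cell_value A w)"
  by (simp add: eigmat_eq cell_value_def[abs_def])

section \<open>Arithmetic of diagonal matrices\<close>

lemma diag_mat_mult_vector: "diag_mat d *v x = (\<chi> l. d l * x $ l)"
  by (simp add: vec_eq_iff matrix_vector_mult_def diag_mat_def if_distrib[of "\<lambda>a. a * _"]
      cong: if_cong)

lemma diag_mat_mult: "diag_mat a ** diag_mat b = diag_mat (\<lambda>l. a l * b l)"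
  by (simp add: vec_eq_iff matrix_matrix_mult_def diag_mat_def if_distrib[of "\<lambda>a. a * _"]
      cong: if_cong)

lemma diag_map_diag_mat: "diag_map f (diag_mat d) = diag_mat (\<lambda>l. f (d l))"
  by (simp add: diag_map_def diag_mat_def)

lemma diag_mat_add: "diag_mat a + diag_mat b = diag_mat (\<lambda>l. a l + b l)"
  by (simp add: vec_eq_iff diag_mat_def)

lemma scaleR_diag_mat: "c *\<^sub>R diag_mat a = diag_mat (\<lambda>l. c * a l)"
  by (simp add: vec_eq_iff diag_mat_def)

lemma invertible_diag_mat: "invertible (diag_mat d) \<longleftrightarrow> (\<forall>l. d l \<noteq> 0)"
proof -
  have "det (diag_mat d) = (\<Prod>l\<in>UNIV. d l)"
    by (subst det_diagonal) (auto simp: diag_mat_def)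
  thus ?thesis by (simp add: invertible_det_nz)
qed

text \<open>Swapping the sums brings out the column orthogonality of \<open>A\<close>; the opposite
  composition below uses the row orthogonality.\<close>

lemma cell_value_cell_modes:
  fixes A :: "'k::{finite,linorder} sqmat"
  assumes "haar_type A"
  shows "cell_value A (cell_modes A d) = d"
proof
  fix m
  have "cell_value A (cell_modes A d) m
      = (\<Sum>k\<in>UNIV. \<Sum>l\<in>UNIV. d l * (A $ k $ l * A $ k $ m)) / real CARD('k)"
    by (simp add: cell_value_def cell_modes_def sum_distrib_left sum_distrib_right
        sum_divide_distrib mult_ac)
  also have "\<dots> = d m"
    by (subst sum.swap)
      (simp add: haar_type_columns[OF assms] if_distrib flip: sum_distrib_left cong: if_cong)
  finally show "cell_value A (cell_modes A d) m = d m" .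
qed

lemma cell_modes_cell_value:
  fixes A :: "'k::{finite,linorder} sqmat"
  assumes "haar_type A"
  shows "cell_modes A (cell_value A w) = w"
proof -
  have "cell_modes A (cell_value A w) $ m = w $ m" for m
  proof -
    have "cell_modes A (cell_value A w) $ m
        = (\<Sum>l\<in>UNIV. \<Sum>k\<in>UNIV. w $ k * (A $ m $ l * A $ k $ l)) / real CARD('k)"
      by (simp add: cell_value_def cell_modes_def sum_distrib_left mult_ac)
    also have "\<dots> = w $ m"
      by (subst sum.swap)
        (simp add: haar_type_rows[OF assms] if_distrib flip: sum_distrib_left cong: if_cong)
    finally show ?thesis .
  qed
  thus ?thesis by (simp add: vec_eq_iff)
qed

lemma transpose_haar_orth_ehat1:
  fixes A :: "'k::{finite,linorder} sqmat"
  assumes "haar_type A"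
  shows "(transpose (haar_orth A) *v ehat1) $ l = 1 / sqrt (real CARD('k))"
proof -
  obtain z :: 'k where z: "pos z = 0"
    using bij_betw_pos[where 'k = 'k] by (metis bij_betw_iff_bijections lessThan_iff zero_less_card_finite)
  have "(transpose (haar_orth A) *v ehat1) $ l
      = (\<Sum>k\<in>UNIV. if k = z then A $ k $ l / sqrt (real CARD('k)) else 0)"
    unfolding matrix_vector_mult_def vec_lambda_beta
  proof (rule sum.cong[OF refl])
    show "transpose (haar_orth A) $ l $ k * ehat1 $ k
        = (if k = z then A $ k $ l / sqrt (real CARD('k)) else 0)" for k
      using z pos_eq_iff[of k z] by (auto simp: transpose_def haar_orth_def ehat1_def)
  qed
  thus ?thesis by (simp add: haar_type_first_row[OF assms z])
qed

text \<open>The transpose of \<open>H\<close> maps \<open>ehat1\<close> to a constant vector, so the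
  diagonal entries come out as cell values and \<open>H\<close> turns them into modes. Hence
  functions of \<open>D(w)\<close> act cell by cell.\<close>

lemma haar_diag_modes:
  fixes A :: "'k::{finite,linorder} sqmat"
  assumes "haar_type A"
  shows "(haar_orth A ** diag_mat d ** transpose (haar_orth A)) *v ehat1 = cell_modes A d"
proof -
  have "diag_mat d *v (transpose (haar_orth A) *v ehat1) = (\<chi> l. d l / sqrt (real CARD('k)))"
    by (simp only: diag_mat_mult_vector transpose_haar_orth_ehat1[OF assms]) simp
  hence "(haar_orth A ** diag_mat d ** transpose (haar_orth A)) *v ehat1
      = haar_orth A *v (\<chi> l. d l / sqrt (real CARD('k)))"
    by (simp flip: matrix_vector_mul_assoc)
  thus ?thesis
    by (simp add: vec_eq_iff matrix_vector_mult_def haar_orth_def cell_modes_def sum_divide_distrib)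
qed

section \<open>Norm and flux in cell values\<close>

definition cell_state :: "'k::{finite,linorder} sqmat \<Rightarrow> real ^ (2 \<times> 'k) \<Rightarrow> 'k \<Rightarrow> real ^ 2" where
  "cell_state A u l = (\<chi> d. cell_value A (modes u d) l)"

text \<open>Squares, sum and root are all taken cell by cell; the absolute value under the root acts
  on a sum of squares and changes nothing.\<close>

lemma norm_modes_eq:
  fixes A :: "'k::{finite,linorder} sqmat"
  assumes "haar_type A"
  shows "norm_modes A u = cell_modes A (\<lambda>l. norm (cell_state A u l))"
proof -
  have add: "cell_modes A d + cell_modes A d' = cell_modes A (\<lambda>l. d l + d' l)" for d d'
    by (simp add: vec_eq_iff cell_modes_def sum.distrib add_divide_distrib algebra_simps)
  have "norm_sq_modes A u = cell_modes A (\<lambda>l. (norm (cell_state A u l))\<^sup>2)"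
    by (simp add: norm_sq_modes_def eigmat_cell_value[OF assms] diag_map_diag_mat haar_diag_modes[OF assms] sum_2 add
        norm_vec_def L2_set_def cell_state_def)
  thus ?thesis
    by (simp add: norm_modes_def eigmat_cell_value[OF assms] diag_map_diag_mat haar_diag_modes[OF assms]
        cell_value_cell_modes[OF assms])
qed

text \<open>In the Galerkin product the two inner orthogonal factors cancel, so the cell values of
  \<open>v\<close> and of the norm are multiplied.\<close>

lemma gpc_flux_eq:
  fixes A :: "'k::{finite,linorder} sqmat"
  assumes "haar_type A"
  shows "gpc_flux A d u v $ (i, k) = (if i = d
     then cell_modes A (\<lambda>l. cell_value A v l * norm (cell_state A u l)) $ k else 0)"
proof -
  have "galerkin_prod A v (cell_modes A r) = cell_modes A (\<lambda>l. cell_value A v l * r l)" for r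
  proof -
    let ?H = "haar_orth A"
    have HH: "transpose ?H ** ?H = mat 1"
      using haar_type_orthogonal(2)[OF assms] by (simp add: orthogonal_matrix_def)
    have "galerkin_prod A v (cell_modes A r)
      = (?H ** diag_mat (cell_value A v) ** (transpose ?H ** ?H) ** diag_mat r ** transpose ?H) *v ehat1"
      by (simp add: galerkin_prod_def galerkin_matrix_eigmat[OF assms] eigmat_cell_value[OF assms]
          haar_diag_modes[OF assms, symmetric] matrix_vector_mul_assoc matrix_mul_assoc)
    also have "\<dots> = cell_modes A (\<lambda>l. cell_value A v l * r l)"
      by (simp add: HH diag_mat_mult haar_diag_modes[OF assms] flip: matrix_mul_assoc)
         (simp add: diag_mat_mult haar_diag_modes[OF assms] matrix_mul_assoc)
    finally show ?thesis .
  qed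
  thus ?thesis by (simp add: gpc_flux_def norm_modes_eq[OF assms])
qed

section \<open>Galerkin projection\<close>

lemma indicator_cell:
  fixes l m :: "'k::{finite,linorder}"
  assumes "real (pos l) < real CARD('k) * \<xi>" "real CARD('k) * \<xi> < real (pos l) + 1"
  shows "indicator {0..1} (real CARD('k) * \<xi> - real (pos m)) = (if m = l then 1 else 0 :: real)"
proof -
  have "pos m < pos l \<or> pos l < pos m \<or> m = l" by (metis linorder_neqE_nat pos_eq_iff)
  thus ?thesis using assms by (auto simp: indicator_def)
qed

lemma haar_basis_cell:
  fixes A :: "'k::{finite,linorder} sqmat"
  assumes "real (pos l) < real CARD('k) * \<xi>" "real CARD('k) * \<xi> < real (pos l) + 1"
  shows "haar_basis A k \<xi> = A $ k $ l" "expansion A w \<xi> = cell_value A w l"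
proof -
  show *: "haar_basis A k \<xi> = A $ k $ l" for k
    unfolding haar_basis_def indicator_cell[OF assms] by (simp add: if_distrib cong: if_cong)
  show "expansion A w \<xi> = cell_value A w l"
    by (simp add: expansion_def cell_value_def *)
qed

lemma haar_basis_measurable [measurable]: "haar_basis A k \<in> borel_measurable borel"
  unfolding haar_basis_def by measurable

lemma expansion_measurable [measurable]: "expansion A w \<in> borel_measurable borel"
  unfolding expansion_def by measurable

text \<open>Adjacent indicators overlap at the cell boundaries, so cellwise identities only hold almost
  everywhere.\<close>

lemma inner_P_cellwise:
  fixes a b :: "'k::{finite,linorder} \<Rightarrow> real"
  assumes [measurable]: "f \<in> borel_measurable borel" "g \<in> borel_measurable borel"
  assumes fg: "\<And>\<xi> l. real (pos l) < real CARD('k) * \<xi> \<Longrightarrow> real CARD('k) * \<xi> < real (pos l) + 1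
      \<Longrightarrow> f \<xi> = a l \<and> g \<xi> = b l"
  shows "inner_P f g = (\<Sum>l\<in>UNIV. a l * b l) / real CARD('k)"
proof -
  let ?N = "real CARD('k)" and ?U = "uniform_measure lborel {0..1::real}"
  define I where "I = (\<lambda>(l::'k) \<xi>. indicator {0..1} (?N * \<xi> - real (pos l)) :: real)"
  \<comment> \<open>The triple product of equal indicators has the shape integrated in
    \<open>inner_P_cells\<close>; inside a cell it is the plain indicator.\<close>
  define h where "h = (\<lambda>\<xi>. \<Sum>l\<in>UNIV. a l * b l * (I l \<xi> * (I l \<xi> * I l \<xi>)))"
  have "has_bochner_integral ?U h (\<Sum>l\<in>UNIV. a l * b l * (if l = l \<and> l = l then 1 / ?N else 0))"
    unfolding h_def I_def
    by (intro has_bochner_integral_sum has_bochner_integral_mult_right inner_P_cells)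
  hence h: "has_bochner_integral ?U h ((\<Sum>l\<in>UNIV. a l * b l) / ?N)"
    by (simp add: sum_divide_distrib)
  have [measurable]: "h \<in> borel_measurable borel"
    unfolding h_def I_def by measurable
  \<comment> \<open>All cell boundaries, including 0 and 1.\<close>
  define S where "S = (\<lambda>m. real m / ?N) ` {..CARD('k)}"
  have "AE \<xi> in lborel. \<xi> \<notin> S"
    by (intro AE_not_in countable_imp_null_set_lborel) (simp add: S_def)
  hence "AE \<xi> in lborel. \<xi> \<in> {0..1} \<longrightarrow> f \<xi> * g \<xi> = h \<xi>"
  proof eventually_elim
    case (elim \<xi>)
    show ?case
    proof
      assume \<xi>: "\<xi> \<in> {0..1}"
      \<comment> \<open>The floor is the number of the cell. Avoiding \<open>S\<close> makes the
        lower bound strict and excludes \<open>m = K + 1\<close>, which would occur at the right end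
        point 1.\<close>
      define m where "m = nat \<lfloor>?N * \<xi>\<rfloor>"
      have N: "?N > 0" by simp
      have "?N * \<xi> \<ge> 0" "?N * \<xi> \<le> ?N" using \<xi> by (auto simp: mult_left_le)
      hence m: "real m \<le> ?N * \<xi>" "?N * \<xi> < real m + 1"
        unfolding m_def by (simp_all add: of_nat_floor)
      have "\<xi> \<noteq> real j / ?N" if "j \<le> CARD('k)" for j
        using elim that by (auto simp: S_def)
      hence ne: "?N * \<xi> \<noteq> real j" if "j \<le> CARD('k)" for j
        using that N by (auto simp: field_simps)
      have "m < CARD('k)"
        using m(1) \<open>?N * \<xi> \<le> ?N\<close> ne[of "CARD('k)"] by linarith
      then obtain l :: 'k where l: "pos l = m"
        using bij_betw_pos[where 'k = 'k] by (metis bij_betw_iff_bijections lessThan_iff)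
      have cell: "real (pos l) < ?N * \<xi>" "?N * \<xi> < real (pos l) + 1"
        using m ne[of m] \<open>m < CARD('k)\<close> by (auto simp: l)
      show "f \<xi> * g \<xi> = h \<xi>"
        using fg[OF cell] by (simp add: h_def I_def indicator_cell[OF cell] if_distrib cong: if_cong)
    qed
  qed
  hence "AE \<xi> in ?U. f \<xi> * g \<xi> = h \<xi>"
    by (intro AE_uniform_measureI) auto
  hence "inner_P f g = (LINT \<xi>|?U. h \<xi>)"
    unfolding inner_P_def by (intro integral_cong_AE) auto
  thus ?thesis using h by (simp add: has_bochner_integral_integral_eq)
qed

text \<open>Boundaries are a null set, so the values in the open cells determine the projection
  integrals.\<close>

lemma galerkin_projection_cellwise:
  fixes A :: "'k::{finite,linorder} sqmat"
  assumes "\<And>i. (\<lambda>\<xi>. q \<xi> $ i) \<in> borel_measurable borel"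
  assumes "\<And>\<xi> l. real (pos l) < real CARD('k) * \<xi> \<Longrightarrow> real CARD('k) * \<xi> < real (pos l) + 1
      \<Longrightarrow> q \<xi> = a l"
  shows "galerkin_projection A q = (\<chi> p. cell_modes A (\<lambda>l. a l $ fst p) $ snd p)"
proof -
  have "inner_P (\<lambda>\<xi>. q \<xi> $ i) (haar_basis A k) = (\<Sum>l\<in>UNIV. a l $ i * A $ k $ l) / real CARD('k)" for i k
    using assms by (intro inner_P_cellwise) (auto simp: haar_basis_cell)
  thus ?thesis by (simp add: galerkin_projection_def cell_modes_def mult.commute)
qed

lemma galerkin_projection_expansion2:
  fixes A :: "'k::{finite,linorder} sqmat"
  assumes "haar_type A"
  shows "galerkin_projection A (expansion2 A u) = u"
proof -
  have "galerkin_projection A (expansion2 A u)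
      = (\<chi> p. cell_modes A (\<lambda>l. cell_state A u l $ fst p) $ snd p)"
    by (rule galerkin_projection_cellwise)
      (auto simp: expansion2_def cell_state_def haar_basis_cell expansion_measurable)
  thus ?thesis
    by (simp add: cell_state_def cell_modes_cell_value[OF assms] modes_def vec_eq_iff)
qed

text \<open>The flux of a cellwise constant state is again cellwise constant. Its projection
  therefore loses nothing and has the cell values found in \<open>gpc_flux_eq\<close>.\<close>

lemma galerkin_projection_flux:
  fixes A :: "'k::{finite,linorder} sqmat"
  assumes "haar_type A"
  shows "galerkin_projection A (\<lambda>\<xi>. level_set_flux d (expansion2 A u \<xi>) (expansion A v \<xi>))
    = gpc_flux A d u v"
proof -
  have "galerkin_projection A (\<lambda>\<xi>. level_set_flux d (expansion2 A u \<xi>) (expansion A v \<xi>))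
      = (\<chi> p. cell_modes A (\<lambda>l. level_set_flux d (cell_state A u l) (cell_value A v l) $ fst p) $ snd p)"
  proof (rule galerkin_projection_cellwise)
    show "(\<lambda>\<xi>. level_set_flux d (expansion2 A u \<xi>) (expansion A v \<xi>) $ i) \<in> borel_measurable borel" for i
      by (cases "i = d") (simp_all add: level_set_flux_def expansion2_def norm_vec_def L2_set_def)
  qed (auto simp: expansion2_def cell_state_def haar_basis_cell)
  thus ?thesis
    by (auto simp: vec_eq_iff gpc_flux_eq[OF assms] level_set_flux_def cell_modes_def)
qed

section \<open>Spectrum of the flux Jacobian\<close>

text \<open>The determinant is a polynomial in the entries with integer coefficients. This is used
  to evaluate \<open>char_poly\<close> at real and complex points.\<close>

lemma det_ring_hom:
  fixes h :: "'a::comm_ring_1 \<Rightarrow> 'b::comm_ring_1" and M :: "'a ^ 'n ^ 'n"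
  assumes one: "h 1 = 1" and add: "\<And>x y. h (x + y) = h x + h y"
    and mult: "\<And>x y. h (x * y) = h x * h y"
  shows "h (det M) = det (\<chi> i j. h (M $ i $ j))"
proof -
  have zero: "h 0 = 0" using add[of 0 0] by simp
  have minus: "h (- x) = - h x" for x
    using add[of x "- x"] by (simp add: zero add_eq_0_iff)
  have sum: "h (sum f S) = (\<Sum>x\<in>S. h (f x))" if "finite S" for f :: "('n \<Rightarrow> 'n) \<Rightarrow> 'a" and S
    using that by induction (auto simp: zero add)
  have prod: "h (prod f S) = (\<Prod>x\<in>S. h (f x))" if "finite S" for f :: "'n \<Rightarrow> 'a" and S
    using that by induction (auto simp: one mult)
  have sign: "h (of_int (sign p)) = of_int (sign p)" for p :: "'n \<Rightarrow> 'n"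
    by (cases p rule: sign_cases) (simp_all add: one minus)
  show ?thesis
    by (simp add: det_def sum finite_permutations mult prod sign)
qed

text \<open>If a permutation contributes, then \<open>r\<close> never decreases along it, and it
  increases wherever a point is moved. As a permutation preserves the sum of \<open>r\<close>,
  nothing is moved. The rank \<open>r\<close> stands in for an order on the index type.\<close>

lemma det_triangular:
  fixes M :: "'a::comm_ring_1 ^ 'n ^ 'n" and r :: "'n \<Rightarrow> nat"
  assumes "\<And>i j. i \<noteq> j \<Longrightarrow> M $ i $ j \<noteq> 0 \<Longrightarrow> r i < r j"
  shows "det M = (\<Prod>i\<in>UNIV. M $ i $ i)"
proof -
  have zero: "(\<Prod>i\<in>UNIV. M $ i $ p i) = 0" if p: "p permutes UNIV" "p \<noteq> id" for p
  proof (rule ccontr)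
    assume "(\<Prod>i\<in>UNIV. M $ i $ p i) \<noteq> 0"
    hence nz: "M $ i $ p i \<noteq> 0" for i
      using prod_zero[of UNIV "\<lambda>i. M $ i $ p i"] by auto
    have le: "r i \<le> r (p i)" for i
      using assms[OF _ nz, of i] by (cases "p i = i") auto
    obtain k where k: "p k \<noteq> k" using p(2) by (auto simp: fun_eq_iff)
    hence "r k < r (p k)" using assms[OF _ nz, of k] by auto
    hence "(\<Sum>i\<in>UNIV. r i) < (\<Sum>i\<in>UNIV. r (p i))"
      using le by (intro sum_strict_mono_ex1) auto
    moreover have "(\<Sum>i\<in>UNIV. r (p i)) = (\<Sum>i\<in>UNIV. r i)"
      using sum.permute[OF p(1), of r] by (simp add: o_def)
    ultimately show False by simp
  qed
  have "det M = (\<Sum>p\<in>{id}. of_int (sign p) * (\<Prod>i\<in>UNIV. M $ i $ p i))"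
    unfolding det_def
    by (rule sum.mono_neutral_right) (auto simp: finite_permutations permutes_id zero)
  thus ?thesis by (simp add: sign_id)
qed

section \<open>Characteristic polynomial and complex spectrum\<close>

lemma poly_char_poly: "poly (char_poly M) x = det (mat x - M)"
  unfolding char_poly_def
  by (subst det_ring_hom[where h = "\<lambda>p. poly p x"])
    (auto simp: mat_def vec_eq_iff intro!: arg_cong[of _ _ det])

lemma map_poly_of_real_simps:
  "map_poly complex_of_real (p + q) = map_poly of_real p + map_poly of_real q"
  "map_poly complex_of_real (p * q) = map_poly of_real p * map_poly of_real q"
  by (auto simp: poly_eq_iff coeff_map_poly coeff_mult)

lemma poly_of_real_char_poly:
  "poly (map_poly complex_of_real (char_poly M)) \<mu>
     = det (mat \<mu> - (\<chi> i j. complex_of_real (M $ i $ j)))"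
  unfolding char_poly_def
  by (subst det_ring_hom[where h = "\<lambda>p. poly (map_poly complex_of_real p) \<mu>"])
    (auto simp: map_poly_of_real_simps mat_def vec_eq_iff map_poly_pCons
      intro!: arg_cong[of _ _ det])

lemma complex_spectrum_char_poly:
  "complex_spectrum M = {\<mu>. poly (map_poly complex_of_real (char_poly M)) \<mu> = 0}"
proof -
  let ?M = "\<chi> i j. complex_of_real (M $ i $ j)"
  have "\<mu> \<in> complex_spectrum M \<longleftrightarrow> det (mat \<mu> - ?M) = 0" for \<mu>
  proof -
    have mat: "mat \<mu> *v z = \<mu> *s z" for z :: "complex ^ 'a"
      by (simp add: vec_eq_iff matrix_vector_mult_def mat_def if_distrib[of "\<lambda>a. a * _"] cong: if_cong)
    have "(mat \<mu> - ?M) *v z = 0 \<longleftrightarrow> ?M *v z = \<mu> *s z" for z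
      by (auto simp: matrix_vector_mult_diff_rdistrib mat)
    moreover have "det X = 0 \<longleftrightarrow> (\<exists>z. z \<noteq> 0 \<and> X *v z = 0)" for X :: "complex ^ 'a ^ 'a"
      by (metis invertible_det_nz invertible_left_inverse matrix_left_invertible_ker)
    ultimately show ?thesis by (simp add: complex_spectrum_def)
  qed
  thus ?thesis by (auto simp: poly_of_real_char_poly)
qed

text \<open>The polynomial identity already fixes the eigenvalues: the complex roots of a product of
  real linear factors are the listed entries.\<close>

lemma has_spectrumI:
  assumes "char_poly M = prod_list (map (\<lambda>D. \<Prod>l\<in>UNIV. [:- (D $ l $ l), 1:]) Ds)"
  shows "has_spectrum M Ds"
proof -
  have prod: "poly (map_poly complex_of_real (\<Prod>l\<in>S. f l)) \<mu>
      = (\<Prod>l\<in>S. poly (map_poly complex_of_real (f l)) \<mu>)" if "finite S"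
    for f :: "'b \<Rightarrow> real poly" and \<mu> S
    using that by induction (auto simp: map_poly_of_real_simps)
  have "poly (map_poly complex_of_real
        (prod_list (map (\<lambda>D. \<Prod>l\<in>UNIV. [:- (D $ l $ l), 1:]) Ds))) \<mu> = 0
    \<longleftrightarrow> (\<exists>D\<in>set Ds. \<exists>l. \<mu> = complex_of_real (D $ l $ l))" for \<mu>
    by (induction Ds) (auto simp: map_poly_of_real_simps prod map_poly_pCons)
  thus ?thesis
    using assms by (auto simp: has_spectrum_def complex_spectrum_char_poly)
qed

section \<open>Block decomposition of the flux Jacobian\<close>

lemma sum_UNIV_prod:
  "(\<Sum>q\<in>(UNIV :: ('a::finite \<times> 'b::finite) set). f q) = (\<Sum>a\<in>UNIV. \<Sum>b\<in>UNIV. f (a, b))"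
  by (simp add: sum.cartesian_product)

lemma prod_UNIV_prod:
  "(\<Prod>q\<in>(UNIV :: ('a::finite \<times> 'b::finite) set). f q) = (\<Prod>a\<in>UNIV. \<Prod>b\<in>UNIV. f (a, b))"
  by (simp add: prod.cartesian_product)

text \<open>In cell coordinates these are the blocks \<open>c l\<close> times the outer product of
  \<open>n\<close> and \<open>G l\<close>. Keeping \<open>G\<close> free lets one formula cover the
  classical Jacobians, their limits and convex combinations.\<close>

definition flux_jacobian ::
  "'k::{finite,linorder} sqmat \<Rightarrow> real ^ 2 \<Rightarrow> ('k \<Rightarrow> real) \<Rightarrow> ('k \<Rightarrow> real ^ 2)
     \<Rightarrow> real ^ (2 \<times> 'k) ^ (2 \<times> 'k)" where
  "flux_jacobian A n c G = (\<chi> p q. n $ fst p *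
     (\<Sum>l\<in>UNIV. A $ snd p $ l * c l * G l $ fst q * A $ snd q $ l) / real CARD('k))"

text \<open>In the basis \<open>R \<otimes> A\<close>, with a rotation \<open>R\<close> whose first column is \<open>n\<close>, the matrix
  decouples into \<open>2 \<times> 2\<close> blocks, one per cell, whose second row vanishes.\<close>

lemma char_poly_flux_jacobian:
  fixes A :: "'k::{finite,linorder} sqmat"
  assumes A: "haar_type A" and n: "norm n = 1"
  shows "char_poly (flux_jacobian A n c G)
     = (\<Prod>l\<in>UNIV. [:- (c l * (n \<bullet> G l)), 1:]) * (\<Prod>l\<in>(UNIV :: 'k set). [:0, 1:])"
proof -
  define R :: "real ^ 2 ^ 2" where
    "R = (\<chi> i j. if j = 1 then n $ i else if i = 1 then - n $ 2 else n $ 1)"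
  define P :: "real ^ (2 \<times> 'k) ^ (2 \<times> 'k)" where
    "P = (\<chi> p q. R $ fst p $ fst q * A $ snd p $ snd q)"
  \<comment> \<open>The matrix in the new basis: its range lies in the direction \<open>n\<close>,
    the first column of \<open>R\<close>, so only rows with first component 1 are nonzero, and
    different cells do not interact.\<close>
  define T :: "real ^ (2 \<times> 'k) ^ (2 \<times> 'k)" where
    "T = (\<chi> p q. if fst p = 1 \<and> snd p = snd q
       then c (snd p) * (\<Sum>j\<in>UNIV. G (snd p) $ j * R $ j $ fst q) else 0)"
  let ?J = "flux_jacobian A n c G" and ?N = "real CARD('k)"
  have nn: "n $ 1 * n $ 1 + n $ 2 * n $ 2 = 1"
    using n by (simp add: norm_eq_1 inner_vec_def sum_2)
  have RR: "(\<Sum>a\<in>UNIV. R $ i $ a * R $ j $ a) = (if i = j then 1 else 0)" for i j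
    using exhaust_2[of i] exhaust_2[of j] nn by (auto simp: R_def sum_2 algebra_simps)
  have "P ** transpose P = ?N *\<^sub>R mat 1"
  proof -
    have "(P ** transpose P) $ (i, k) $ (j, m)
        = (\<Sum>a\<in>UNIV. R $ i $ a * R $ j $ a) * (\<Sum>l\<in>UNIV. A $ k $ l * A $ m $ l)" for i k j m
      unfolding sum_product
      by (simp add: matrix_matrix_mult_def transpose_def P_def sum_UNIV_prod mult_ac)
    thus ?thesis by (auto simp: vec_eq_iff mat_def RR haar_type_rows[OF A])
  qed
  hence "P ** ((1 / ?N) *\<^sub>R transpose P) = mat 1"
    by (simp add: matrix_scalar_ac flip: scalar_matrix_assoc)
  hence P: "det P \<noteq> 0"
    by (metis invertible_det_nz invertible_right_inverse)
  have JP: "?J ** P = P ** T"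
  proof -
    have "(?J ** P) $ (i, k) $ (b, m) = (P ** T) $ (i, k) $ (b, m)" for i k b m
    proof -
      have "(?J ** P) $ (i, k) $ (b, m)
        = (\<Sum>j\<in>UNIV. \<Sum>p\<in>UNIV. \<Sum>l\<in>UNIV.
              n $ i * A $ k $ l * c l * G l $ j * R $ j $ b / ?N * (A $ p $ l * A $ p $ m))"
        by (simp add: matrix_matrix_mult_def flux_jacobian_def P_def sum_UNIV_prod
            sum_distrib_left sum_distrib_right sum_divide_distrib mult_ac)
      also have "\<dots> = (\<Sum>j\<in>UNIV. \<Sum>l\<in>UNIV.
              n $ i * A $ k $ l * c l * G l $ j * R $ j $ b / ?N * (\<Sum>p\<in>UNIV. A $ p $ l * A $ p $ m))"
        unfolding sum_distrib_left by (rule sum.cong[OF refl], rule sum.swap)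
      also have "\<dots> = (\<Sum>j\<in>UNIV. n $ i * A $ k $ m * c m * G m $ j * R $ j $ b)"
        by (simp add: haar_type_columns[OF A] if_distrib[of "\<lambda>a. _ * a"] cong: if_cong)
      \<comment> \<open>Only the first component survives in the rows of \<open>T\<close>, and the
        first column of \<open>R\<close> supplies the factor \<open>n $ i\<close>.\<close>
      also have "\<dots> = (P ** T) $ (i, k) $ (b, m)"
        by (simp add: matrix_matrix_mult_def P_def T_def R_def sum_UNIV_prod sum_2
            if_distrib[of "\<lambda>a. _ * a"] algebra_simps cong: if_cong)
      finally show ?thesis .
    qed
    thus ?thesis by (auto simp: vec_eq_iff)
  qed
  have "det (mat x - ?J) = (\<Prod>l\<in>UNIV. x - c l * (n \<bullet> G l)) * (\<Prod>l\<in>(UNIV :: 'k set). x)" for x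
  proof -
    have mat: "mat x = (x *\<^sub>R mat 1 :: real ^ (2 \<times> 'k) ^ (2 \<times> 'k))"
      by (simp add: vec_eq_iff mat_def)
    have diff: "(X - Y) ** Z = X ** Z - Y ** Z" "Z ** (X - Y) = Z ** X - Z ** Y"
      for X Y Z :: "real ^ (2 \<times> 'k) ^ (2 \<times> 'k)"
      by (simp_all add: vec_eq_iff matrix_matrix_mult_def sum_subtractf algebra_simps)
    have "(mat x - ?J) ** P = P ** (mat x - T)"
      by (simp add: diff JP mat matrix_scalar_ac flip: scalar_matrix_assoc)
    hence "det (mat x - ?J) * det P = det P * det (mat x - T)"
      by (metis det_mul)
    hence "det (mat x - ?J) = det (mat x - T)" using P by simp
    also have "\<dots> = (\<Prod>p\<in>UNIV. (mat x - T) $ p $ p)"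
    \<comment> \<open>An off-diagonal entry can only lead from the first to the second component of
      the same cell.\<close>
    proof (rule det_triangular[where r = "\<lambda>p. if fst p = 1 then 0 else 1"])
      show "(if fst p = 1 then 0 else 1 :: nat) < (if fst q = 1 then 0 else 1)"
        if "p \<noteq> q" "(mat x - T) $ p $ q \<noteq> 0" for p q
        using that by (auto simp: mat_def T_def prod_eq_iff split: if_splits)
    qed
    also have "\<dots> = (\<Prod>l\<in>UNIV. x - c l * (n \<bullet> G l)) * (\<Prod>l\<in>(UNIV :: 'k set). x)"
      by (simp add: prod_UNIV_prod UNIV_2 mat_def T_def R_def sum_2 inner_vec_def mult.commute)
    finally show ?thesis .
  qed
  \<comment> \<open>Real polynomials that agree at every real point are equal.\<close>
  thus ?thesis
    by (intro iffD1[OF poly_eq_poly_eq_iff] ext)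
      (simp add: poly_char_poly poly_prod del: prod_constant)
qed

lemma has_spectrum_flux_jacobian:
  fixes A :: "'k::{finite,linorder} sqmat"
  assumes "haar_type A" "norm n = 1" "\<And>l. d l = c l * (n \<bullet> G l)"
  shows "has_spectrum (flux_jacobian A n c G) [diag_mat d, 0 :: 'k sqmat]"
  using char_poly_flux_jacobian[OF assms(1,2), of c G]
  by (intro has_spectrumI) (simp add: assms(3) diag_mat_def)

section \<open>Generalized Jacobian of the flux\<close>

text \<open>An arbitrary vector \<open>n\<close> covers both the fluxes in the coordinate
  directions, for \<open>n = axis d 1\<close>, and their normal combination.\<close>

definition galerkin_flux ::
  "'k::{finite,linorder} sqmat \<Rightarrow> real ^ 2 \<Rightarrow> ('k \<Rightarrow> real) \<Rightarrow> real ^ (2 \<times> 'k) \<Rightarrow> real ^ (2 \<times> 'k)" where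
  "galerkin_flux A n c w =
     (\<chi> p. n $ fst p * cell_modes A (\<lambda>l. c l * norm (cell_state A w l)) $ snd p)"

section \<open>Classical derivative of the flux\<close>

lemma bounded_linear_cell_state: "bounded_linear (\<lambda>w. cell_state A w l)"
  by (rule linear_conv_bounded_linear[THEN iffD1], rule linearI)
    (auto simp: cell_state_def cell_value_def modes_def vec_eq_iff sum.distrib sum_distrib_left
      algebra_simps)

lemma flux_jacobian_mult_vector:
  "(flux_jacobian A n c G *v h) $ p
     = n $ fst p * cell_modes A (\<lambda>l. c l * (G l \<bullet> cell_state A h l)) $ snd p"
proof -
  let ?X = "\<lambda>j m l. n $ fst p * A $ snd p $ l * c l * G l $ j * A $ m $ l * h $ (j, m) / real CARD('a)"
  have "(flux_jacobian A n c G *v h) $ p = (\<Sum>j\<in>UNIV. \<Sum>m\<in>UNIV. \<Sum>l\<in>UNIV. ?X j m l)"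
    by (simp add: flux_jacobian_def matrix_vector_mult_def sum_UNIV_prod sum_distrib_left
        sum_distrib_right sum_divide_distrib mult_ac)
  also have "\<dots> = (\<Sum>j\<in>UNIV. \<Sum>l\<in>UNIV. \<Sum>m\<in>UNIV. ?X j m l)"
    by (rule sum.cong[OF refl], rule sum.swap)
  also have "\<dots> = (\<Sum>l\<in>UNIV. \<Sum>j\<in>UNIV. \<Sum>m\<in>UNIV. ?X j m l)"
    by (rule sum.swap)
  finally show ?thesis
    by (simp add: cell_modes_def cell_state_def cell_value_def modes_def inner_vec_def
        sum_distrib_left sum_divide_distrib mult_ac)
qed

text \<open>The norm is smooth away from 0, and in a cell with \<open>c l = 0\<close> its kink is
  multiplied by zero, so the value \<open>sgn 0\<close> does not enter there.\<close>

lemma has_derivative_galerkin_flux: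
  fixes A :: "'k::{finite,linorder} sqmat"
  assumes "\<And>l. c l = 0 \<or> cell_state A w l \<noteq> 0"
  shows "(galerkin_flux A n c has_derivative
           (\<lambda>h. flux_jacobian A n c (\<lambda>l. sgn (cell_state A w l)) *v h)) (at w)"
proof -
  have l: "((\<lambda>w. c l * norm (cell_state A w l)) has_derivative
      (\<lambda>h. c l * (sgn (cell_state A w l) \<bullet> cell_state A h l))) (at w)" for l
  proof (cases "c l = 0")
    case False
    hence "((\<lambda>w. norm (cell_state A w l)) has_derivative
        (\<lambda>h. cell_state A h l \<bullet> sgn (cell_state A w l))) (at w)"
      using assms[of l] bounded_linear_imp_has_derivative[OF bounded_linear_cell_state]
      by (intro has_derivative_compose[OF _ has_derivative_norm]) auto
    thus ?thesis by (auto intro!: derivative_eq_intros simp: inner_commute)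
  qed simp
  have "((\<lambda>w. galerkin_flux A n c w $ p) has_derivative
      (\<lambda>h. (flux_jacobian A n c (\<lambda>l. sgn (cell_state A w l)) *v h) $ p)) (at w)" for p
    unfolding flux_jacobian_mult_vector galerkin_flux_def cell_modes_def
    by (simp add: divide_inverse)
      (intro has_derivative_mult_right has_derivative_mult_left has_derivative_sum l)
  thus ?thesis
    by (subst has_derivative_componentwise_within) (auto simp: Basis_vec_def inner_axis)
qed

lemma jacobian_galerkin_flux:
  assumes "\<And>l. c l = 0 \<or> cell_state A w l \<noteq> 0"
  shows "jacobian (galerkin_flux A n c) (at w) = flux_jacobian A n c (\<lambda>l. sgn (cell_state A w l))"
  by (simp add: jacobian_def flip: frechet_derivative_at[OF has_derivative_galerkin_flux[OF assms]])

text \<open>Both \<open>abs\<close> and \<open>abs\<close> minus the identity have a minimum at 0,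
  which would force the derivative to be 0 and 1.\<close>

lemma abs_not_differentiable_0: "\<not> (abs :: real \<Rightarrow> real) differentiable at 0"
proof
  assume "(abs :: real \<Rightarrow> real) differentiable at 0"
  then obtain D where D: "(abs has_real_derivative D) (at (0::real))"
    by (auto simp: real_differentiable_def)
  have "D = 0" using DERIV_local_min[OF D, of 1] by auto
  moreover have "((\<lambda>t::real. \<bar>t\<bar> - t) has_real_derivative D - 1) (at 0)"
    by (intro DERIV_diff D DERIV_ident)
  hence "D - 1 = 0" by (rule DERIV_local_min[of _ _ _ 1]) auto
  ultimately show False by simp
qed

text \<open>The inverse of the cell transform; it allows a state to be perturbed in each cell
  independently.\<close>

definition state_of_cells ::
  "'k::{finite,linorder} sqmat \<Rightarrow> ('k \<Rightarrow> real ^ 2) \<Rightarrow> real ^ (2 \<times> 'k)" where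
  "state_of_cells A g = (\<chi> p. cell_modes A (\<lambda>l. g l $ fst p) $ snd p)"

lemma cell_state_of_cells: "haar_type A \<Longrightarrow> cell_state A (state_of_cells A g) l = g l"
  by (simp add: cell_state_def state_of_cells_def modes_def cell_value_cell_modes vec_eq_iff)

text \<open>Along a line that moves the vanishing cell state in a fixed direction, the flux in that
  cell is a nonzero multiple of \<open>abs\<close>. Hence the formula for the Jacobian applies at
  every point of differentiability.\<close>

lemma galerkin_flux_not_differentiable:
  fixes A :: "'k::{finite,linorder} sqmat"
  assumes A: "haar_type A" and n: "n \<noteq> 0"
    and F: "galerkin_flux A n c differentiable at w" and l: "cell_state A w l = 0"
  shows "c l = 0"
proof (rule ccontr)
  assume c: "c l \<noteq> 0"
  obtain i where i: "n $ i \<noteq> 0" using n by (auto simp: vec_eq_iff)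
  define h where "h = state_of_cells A (\<lambda>m. axis 1 1)"
  interpret bounded_linear "\<lambda>w. cell_state A w l" by (rule bounded_linear_cell_state)
  \<comment> \<open>\<open>L\<close> reads off component \<open>i\<close> of the flux in cell
    \<open>l\<close> and divides by the factor in front of the norm.\<close>
  define L where "L = (\<lambda>z. cell_value A (\<chi> k. z $ (i, k)) l / (n $ i * c l))"
  have "linear L"
    by (rule linearI)
      (auto simp: L_def cell_value_def sum.distrib sum_distrib_left algebra_simps add_divide_distrib
        sum_divide_distrib)
  hence L: "bounded_linear L" by (simp add: linear_conv_bounded_linear)
  have "L (galerkin_flux A n c (w + t *\<^sub>R h)) = \<bar>t\<bar>" for t
  proof -
    have "cell_state A (w + t *\<^sub>R h) l = t *\<^sub>R axis 1 1"
      by (simp add: add scaleR l h_def cell_state_of_cells[OF A])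
    moreover have "(\<chi> k. galerkin_flux A n c z $ (i, k))
        = cell_modes A (\<lambda>m. n $ i * (c m * norm (cell_state A z m)))" for z
      by (simp add: galerkin_flux_def cell_modes_def vec_eq_iff sum_distrib_left mult_ac)
    ultimately show ?thesis
      using i c by (simp add: L_def cell_value_cell_modes[OF A])
  qed
  hence eq: "(\<lambda>t. L (galerkin_flux A n c (w + t *\<^sub>R h))) = abs" by (simp add: fun_eq_iff)
  obtain D where D: "(galerkin_flux A n c has_derivative D) (at w)"
    using F by (auto simp: differentiable_def)
  have "((\<lambda>t. w + t *\<^sub>R h) has_derivative (\<lambda>t. t *\<^sub>R h)) (at 0)"
    by (auto intro!: derivative_eq_intros)
  hence "((\<lambda>t. galerkin_flux A n c (w + t *\<^sub>R h)) has_derivative (\<lambda>t. D (t *\<^sub>R h))) (at 0)"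
    by (rule has_derivative_compose) (use D in simp)
  from bounded_linear.has_derivative[OF L this] have "(abs :: real \<Rightarrow> real) differentiable at 0"
    unfolding eq by (rule differentiableI)
  thus False using abs_not_differentiable_0 by simp
qed

section \<open>Convex hulls of Jacobians\<close>

lemma flux_jacobian_affine:
  "flux_jacobian A n c (\<lambda>l. a *\<^sub>R G l + b *\<^sub>R H l)
     = a *\<^sub>R flux_jacobian A n c G + b *\<^sub>R flux_jacobian A n c H"
  by (simp add: vec_eq_iff flux_jacobian_def sum.distrib sum_distrib_left algebra_simps
      add_divide_distrib)

text \<open>One coordinate is convexified at a time, by induction over the set \<open>T\<close> of
  coordinates that are only known to lie in the hull. With the other coordinates fixed, the
  admissible values at \<open>t\<close> form a convex set containing \<open>S t\<close>.\<close>

lemma affine_image_convex_hull_Pi: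
  fixes f :: "('k::finite \<Rightarrow> 'a::real_vector) \<Rightarrow> 'b::real_vector"
  assumes aff: "\<And>a b G H. a + b = 1 \<Longrightarrow> f (\<lambda>l. a *\<^sub>R G l + b *\<^sub>R H l) = a *\<^sub>R f G + b *\<^sub>R f H"
    and G: "\<And>l. G l \<in> convex hull S l"
  shows "f G \<in> convex hull (f ` {G. \<forall>l. G l \<in> S l})"
proof -
  let ?C = "convex hull (f ` {G. \<forall>l. G l \<in> S l})"
  have "f G \<in> ?C" if "finite T" "\<And>l. l \<in> T \<Longrightarrow> G l \<in> convex hull S l" "\<And>l. l \<notin> T \<Longrightarrow> G l \<in> S l" for T G
    using that
  proof (induction T arbitrary: G)
    case empty
    thus ?case by (intro hull_inc) auto
  next
    case (insert t T)
    have "convex {x. f (G(t := x)) \<in> ?C}"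
    proof (rule convexI, clarify)
      fix x y and a b :: real
      assume *: "f (G(t := x)) \<in> ?C" "f (G(t := y)) \<in> ?C" "0 \<le> a" "0 \<le> b" "a + b = 1"
      \<comment> \<open>Away from \<open>t\<close> both copies agree with \<open>G\<close>, and
        \<open>a + b = 1\<close> restores it.\<close>
      have "G(t := a *\<^sub>R x + b *\<^sub>R y) = (\<lambda>l. a *\<^sub>R (G(t := x)) l + b *\<^sub>R (G(t := y)) l)"
        using *(5) by (auto simp: fun_eq_iff simp flip: scaleR_left_distrib)
      hence "f (G(t := a *\<^sub>R x + b *\<^sub>R y)) = a *\<^sub>R f (G(t := x)) + b *\<^sub>R f (G(t := y))"
        by (simp only: aff[OF *(5)])
      thus "f (G(t := a *\<^sub>R x + b *\<^sub>R y)) \<in> ?C"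
        using convexD[OF convex_convex_hull *] by simp
    qed
    moreover have "S t \<subseteq> {x. f (G(t := x)) \<in> ?C}"
      using insert by (auto intro!: insert.IH)
    ultimately have "convex hull S t \<subseteq> {x. f (G(t := x)) \<in> ?C}" by (rule hull_minimal[rotated])
    moreover have "G t \<in> convex hull S t" using insert.prems by auto
    ultimately show ?case by auto
  qed
  from this[of UNIV] G show ?thesis by auto
qed

text \<open>\<open>V = UNIV\<close> gives Clarke's generalized Jacobian, a coordinate line the
  version restricted to states with one vanishing component. The unit vector \<open>e\<close>
  ensures that the unit sphere of \<open>V\<close> is nonempty.\<close>

lemma generalized_jacobian_galerkin_flux:
  fixes A :: "'k::{finite,linorder} sqmat" and V :: "(real ^ 2) set"
  assumes A: "haar_type A" and n: "n \<noteq> 0" and V: "subspace V" and e: "e \<in> V" "norm e = 1"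
    and u: "\<And>l. cell_state A u l \<in> V"
  shows "generalized_jacobian {w. \<forall>l. cell_state A w l \<in> V} (galerkin_flux A n c) u
    = flux_jacobian A n c ` {G. \<forall>l. G l \<in> generalized_sgn (cell_state A u l) \<inter> V}"
proof -
  let ?S = "{w. \<forall>l. cell_state A w l \<in> V}" and ?F = "galerkin_flux A n c"
  let ?J = "flux_jacobian A n c" and ?y = "cell_state A u"
  define L where "L = {M. \<exists>X. (\<forall>m. X m \<in> ?S \<and> ?F differentiable at (X m)) \<and> X \<longlonglongrightarrow> u \<and>
             (\<lambda>m. jacobian ?F (at (X m))) \<longlonglongrightarrow> M}"
  let ?R = "{G. \<forall>l. G l \<in> generalized_sgn (?y l) \<inter> V}"
  have sgnV: "sgn z \<in> V" if "z \<in> V" for z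
    using V that by (simp add: sgn_div_norm subspace_scale)
  have "L \<subseteq> ?J ` ?R"
  proof
    fix M assume "M \<in> L"
    then obtain X where X: "\<And>m l. cell_state A (X m) l \<in> V" "\<And>m. ?F differentiable at (X m)"
      "X \<longlonglongrightarrow> u" "(\<lambda>m. jacobian ?F (at (X m))) \<longlonglongrightarrow> M"
      by (auto simp: L_def)
    \<comment> \<open>Collecting the signs of all cells in one bounded vector yields a subsequence
      that converges in every cell at once.\<close>
    define g :: "nat \<Rightarrow> ((real, 2) vec, 'k) vec" where "g = (\<lambda>m. \<chi> l. sgn (cell_state A (X m) l))"
    have J: "jacobian ?F (at (X m)) = ?J (\<lambda>l. g m $ l)" for m
    proof -
      have "(\<lambda>l. g m $ l) = (\<lambda>l. sgn (cell_state A (X m) l))"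
        by (simp add: g_def fun_eq_iff)
      thus ?thesis
        using galerkin_flux_not_differentiable[OF A n X(2)]
        by (subst jacobian_galerkin_flux) auto
    qed
    have g1: "norm (g m $ l) \<le> 1" for m l by (simp add: g_def norm_sgn)
    have "norm (g m) \<le> (\<Sum>l\<in>(UNIV :: 'k set). 1)" for m
    proof -
      have "norm (g m) \<le> (\<Sum>l\<in>UNIV. norm (g m $ l))"
        by (subst norm_vec_def, rule L2_set_le_sum) simp
      also have "\<dots> \<le> (\<Sum>l\<in>(UNIV :: 'k set). 1)" by (intro sum_mono g1)
      finally show ?thesis .
    qed
    hence "bounded (range g)" by (auto simp: bounded_iff)
    then obtain \<gamma> r where r: "strict_mono r" "(g \<circ> r) \<longlonglongrightarrow> \<gamma>"
      using bounded_imp_convergent_subsequence by blast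
    have lim: "(\<lambda>m. g (r m) $ l) \<longlonglongrightarrow> \<gamma> $ l" for l
      using tendsto_vec_nth[OF r(2)] by (simp add: o_def)
    have "(\<lambda>m. ?J (\<lambda>l. g (r m) $ l)) \<longlonglongrightarrow> ?J (\<lambda>l. \<gamma> $ l)"
      unfolding flux_jacobian_def by (intro tendsto_intros lim) simp
    moreover have "(\<lambda>m. ?J (\<lambda>l. g (r m) $ l)) \<longlonglongrightarrow> M"
      using LIMSEQ_subseq_LIMSEQ[OF X(4) r(1)] by (simp add: o_def J)
    ultimately have M: "M = ?J (\<lambda>l. \<gamma> $ l)" by (rule LIMSEQ_unique[symmetric])
    have "\<gamma> $ l \<in> generalized_sgn (?y l) \<inter> V" for l
    proof -
      have "\<gamma> $ l \<in> V"
        by (rule closed_sequentially[OF closed_subspace[OF V] _ lim]) (simp add: g_def sgnV X(1))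
      moreover have "norm (\<gamma> $ l) \<le> 1"
        by (rule LIMSEQ_le_const2[OF tendsto_norm[OF lim]]) (use g1 in auto)
      \<comment> \<open>\<open>sgn\<close> is continuous away from 0. Where the state vanishes, only
        the bound 1 and membership in \<open>V\<close> pass to the limit.\<close>
      moreover have "\<gamma> $ l = sgn (?y l)" if "?y l \<noteq> 0"
      proof -
        have "(\<lambda>m. cell_state A (X (r m)) l) \<longlonglongrightarrow> ?y l"
          using bounded_linear.tendsto[OF bounded_linear_cell_state LIMSEQ_subseq_LIMSEQ[OF X(3) r(1)]]
          by (simp add: o_def)
        from tendsto_sgn[OF this that] lim[of l] show ?thesis
          by (auto simp: g_def intro: LIMSEQ_unique)
      qed
      ultimately show ?thesis by (auto simp: generalized_sgn_def)
    qed
    thus "M \<in> ?J ` ?R" using M by blast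
  qed
  moreover have "convex (?J ` ?R)"
  proof (rule convexI, clarify)
    fix G H and a b :: real
    assume *: "\<forall>l. G l \<in> generalized_sgn (?y l) \<inter> V" "\<forall>l. H l \<in> generalized_sgn (?y l) \<inter> V"
      "0 \<le> a" "0 \<le> b" "a + b = 1"
    have "convex (generalized_sgn (?y l) \<inter> V)" for l
      using subspace_imp_convex[OF V] by (intro convex_Int) (auto simp: generalized_sgn_def)
    hence "\<forall>l. a *\<^sub>R G l + b *\<^sub>R H l \<in> generalized_sgn (?y l) \<inter> V"
      using convexD[OF _ _ _ *(3-5)] *(1,2) by blast
    thus "a *\<^sub>R ?J G + b *\<^sub>R ?J H \<in> ?J ` ?R"
      by (auto simp flip: flux_jacobian_affine)
  qed
  ultimately have "convex hull L \<subseteq> ?J ` ?R" by (rule hull_minimal)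
  moreover have "?J ` ?R \<subseteq> convex hull L"
  proof clarify
    fix G assume G: "\<forall>l. G l \<in> generalized_sgn (?y l) \<inter> V"
    \<comment> \<open>These are the signs attained as limits: in a vanishing cell the unit vectors
      of \<open>V\<close>, whose hull is the unit ball of \<open>V\<close>.\<close>
    define E where "E = (\<lambda>l. if ?y l = 0 then sphere 0 1 \<inter> V else {sgn (?y l)})"
    have "G l \<in> convex hull E l" for l
    proof (cases "?y l = 0")
      case False
      thus ?thesis using G by (auto simp: generalized_sgn_def E_def split: if_splits)
    next
      case True
      hence Gl: "norm (G l) \<le> 1" "G l \<in> V" using spec[OF G, of l] by (auto simp: generalized_sgn_def)
      \<comment> \<open>With \<open>f\<close> a unit vector along \<open>G l\<close>, the point
        \<open>G l\<close> lies on the segment from \<open>- f\<close> to \<open>f\<close>. For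
        \<open>G l = 0\<close> any direction in \<open>V\<close> will do.\<close>
      define f where "f = (if G l = 0 then e else sgn (G l))"
      have f: "f \<in> V" "norm f = 1" "G l = norm (G l) *\<^sub>R f"
        using e Gl sgnV by (auto simp: f_def norm_sgn sgn_div_norm)
      hence "f \<in> E l" "- f \<in> E l" using V True by (auto simp: E_def subspace_neg)
      hence "((1 + norm (G l)) / 2) *\<^sub>R f + ((1 - norm (G l)) / 2) *\<^sub>R (- f) \<in> convex hull E l"
        using Gl by (intro convexD[OF convex_convex_hull] hull_inc) (auto simp: field_simps)
      also have "((1 + norm (G l)) / 2) *\<^sub>R f + ((1 - norm (G l)) / 2) *\<^sub>R (- f) = norm (G l) *\<^sub>R f"
        by (simp flip: scaleR_left_diff_distrib) (simp add: field_simps)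
      finally show ?thesis using f(3) by simp
    qed
    hence "?J G \<in> convex hull (?J ` {G. \<forall>l. G l \<in> E l})"
      by (intro affine_image_convex_hull_Pi flux_jacobian_affine)
    also have "\<dots> \<subseteq> convex hull L"
    proof (rule hull_mono, clarify)
      fix H assume H: "\<forall>l. H l \<in> E l"
      \<comment> \<open>Moving only the vanishing cells, in the directions \<open>H l\<close>, makes
        every cell state nonzero with sign \<open>H l\<close>; the Jacobians along the sequence are
        then constant.\<close>
      define h where "h = state_of_cells A (\<lambda>l. if ?y l = 0 then H l else 0)"
      define X where "X = (\<lambda>m. u + (1 / real (Suc m)) *\<^sub>R h)"
      have X: "cell_state A (X m) l = (if ?y l = 0 then (1 / real (Suc m)) *\<^sub>R H l else ?y l)" for m l
      proof -
        interpret bounded_linear "\<lambda>w. cell_state A w l" by (rule bounded_linear_cell_state)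
        show ?thesis by (simp add: X_def add scaleR h_def cell_state_of_cells[OF A])
      qed
      have H1: "norm (H l) = 1" "H l \<in> V" if "?y l = 0" for l
        using spec[OF H, of l] that by (auto simp: E_def)
      have nz: "cell_state A (X m) l \<noteq> 0" for m l
        using H1[of l] by (auto simp: X)
      have sgn: "sgn (cell_state A (X m) l) = H l" for m l
        using H1[of l] spec[OF H, of l] by (auto simp: X E_def sgn_div_norm)
      have "X m \<in> ?S" for m using H1 u V by (auto simp: X subspace_scale)
      moreover have "?F differentiable at (X m)" for m
        using has_derivative_galerkin_flux nz differentiableI by blast
      moreover have "jacobian ?F (at (X m)) = ?J H" for m
        by (subst jacobian_galerkin_flux) (auto simp: nz sgn)
      moreover have "X \<longlonglongrightarrow> u + 0 *\<^sub>R h"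
        unfolding X_def by (intro tendsto_intros LIMSEQ_Suc[OF lim_const_over_n])
      ultimately show "?J H \<in> L" by (auto simp: L_def intro!: exI[of _ X])
    qed
    finally show "?J G \<in> convex hull L" .
  qed
  ultimately show ?thesis by (auto simp: generalized_jacobian_def L_def)
qed

section \<open>Level set equations\<close>

lemma gpc_flux_galerkin_flux:
  fixes A :: "'k::{finite,linorder} sqmat"
  assumes "haar_type A"
  shows "gpc_flux A d u v = galerkin_flux A (axis d 1) (cell_value A v) u"
  by (auto simp: vec_eq_iff gpc_flux_eq[OF assms] galerkin_flux_def axis_def)

lemma normal_gpc_flux:
  fixes A :: "'k::{finite,linorder} sqmat" and n :: "real ^ 2"
  assumes "haar_type A"
  shows "n $ 1 *\<^sub>R gpc_flux A 1 w v + n $ 2 *\<^sub>R gpc_flux A 2 w v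
    = galerkin_flux A n (cell_value A v) w"
proof -
  have "(n $ 1 *\<^sub>R gpc_flux A 1 w v + n $ 2 *\<^sub>R gpc_flux A 2 w v) $ (i, k)
    = galerkin_flux A n (cell_value A v) w $ (i, k)" for i k
    using exhaust_2[of i] by (auto simp: gpc_flux_eq[OF assms] galerkin_flux_def)
  thus ?thesis by (auto simp: vec_eq_iff)
qed

lemma normal_flux_jacobian:
  fixes A :: "'k::{finite,linorder} sqmat" and n :: "real ^ 2"
  shows "n $ 1 *\<^sub>R flux_jacobian A (axis 1 1) c G + n $ 2 *\<^sub>R flux_jacobian A (axis 2 1) c G
    = flux_jacobian A n c G"
proof -
  have "(n $ 1 *\<^sub>R flux_jacobian A (axis 1 1) c G + n $ 2 *\<^sub>R flux_jacobian A (axis 2 1) c G) $ (i, k) $ q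
    = flux_jacobian A n c G $ (i, k) $ q" for i k q
    using exhaust_2[of i] by (auto simp: flux_jacobian_def axis_def)
  thus ?thesis by (auto simp: vec_eq_iff)
qed

section \<open>Eigenvalues and spectra of the level set fluxes\<close>

lemma eigmat_norm_modes:
  fixes A :: "'k::{finite,linorder} sqmat"
  assumes "haar_type A"
  shows "eigmat A (norm_modes A u) = diag_mat (\<lambda>l. norm (cell_state A u l))"
  using assms by (simp add: eigmat_cell_value norm_modes_eq cell_value_cell_modes)

lemma eigmat_modes:
  fixes A :: "'k::{finite,linorder} sqmat"
  assumes "haar_type A"
  shows "eigmat A (modes u d) = diag_mat (\<lambda>l. cell_state A u l $ d)"
  using assms by (simp add: eigmat_cell_value cell_state_def)

text \<open>The cell transform is injective. This turns the constraint of a vanishing component into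
  membership of each cell state in a subspace.\<close>

lemma modes_eq_0_iff:
  fixes A :: "'k::{finite,linorder} sqmat"
  assumes "haar_type A"
  shows "modes u j = 0 \<longleftrightarrow> (\<forall>l. cell_state A u l $ j = 0)"
proof
  show "\<forall>l. cell_state A u l $ j = 0" if "modes u j = 0"
    using that by (simp add: cell_state_def cell_value_def)
  assume "\<forall>l. cell_state A u l $ j = 0"
  hence "cell_value A (modes u j) = (\<lambda>l. 0)" by (auto simp: cell_state_def)
  hence "cell_modes A (cell_value A (modes u j)) = 0" by (simp add: cell_modes_def vec_eq_iff)
  thus "modes u j = 0" by (simp add: cell_modes_cell_value[OF assms])
qed

text \<open>Projection recovers the modes from their expansion and maps the random flux to
  \<open>gpc_flux\<close>, so both systems are the same equation.\<close>

lemma gpc_conservation_law: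
  fixes A :: "'k::{finite,linorder} sqmat"
  assumes "haar_type A"
  shows "conservation_law_at
          (\<lambda>t x. galerkin_projection A (expansion2 A (u t x)))
          (\<lambda>d t x. galerkin_projection A
             (\<lambda>\<xi>. level_set_flux d (expansion2 A (u t x) \<xi>) (expansion A (v x) \<xi>))) t x
        \<longleftrightarrow> conservation_law_at u (\<lambda>d t x. gpc_flux A d (u t x) (v x)) t x"
  by (simp add: galerkin_projection_expansion2[OF assms] galerkin_projection_flux[OF assms])

lemma eigmat_norm_modes_sqrt:
  fixes A :: "'k::{finite,linorder} sqmat"
  assumes "haar_type A"
  shows "eigmat A (norm_modes A u) =
          diag_map sqrt (diag_map (\<lambda>x. x\<^sup>2) (eigmat A (modes u 1))
                         + diag_map (\<lambda>x. x\<^sup>2) (eigmat A (modes u 2)))"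
  by (simp add: eigmat_norm_modes[OF assms] eigmat_modes[OF assms] diag_map_diag_mat diag_mat_add
      norm_vec_def L2_set_def sum_2)

text \<open>Invertibility of the eigenvalue matrix of the norm says that no cell state vanishes,
  which puts the flux in the smooth case.\<close>

lemma gpc_flux_spectrum:
  fixes A :: "'k::{finite,linorder} sqmat" and n :: "real ^ 2"
  assumes A: "haar_type A" and n: "norm n = 1" and inv: "invertible (eigmat A (norm_modes A u))"
  shows "(\<lambda>w. gpc_flux A d w v) differentiable at u"
    and "has_spectrum
             (n $ 1 *\<^sub>R jacobian (\<lambda>w. gpc_flux A 1 w v) (at u)
              + n $ 2 *\<^sub>R jacobian (\<lambda>w. gpc_flux A 2 w v) (at u))
             [eigmat A v ** diag_map inverse (eigmat A (norm_modes A u))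
                ** (n $ 1 *\<^sub>R eigmat A (modes u 1) + n $ 2 *\<^sub>R eigmat A (modes u 2)), 0]"
proof -
  have nz: "cell_state A u l \<noteq> 0" for l
    using inv by (simp add: eigmat_norm_modes[OF A] invertible_diag_mat)
  show "(\<lambda>w. gpc_flux A d w v) differentiable at u"
    unfolding gpc_flux_galerkin_flux[OF A] using nz
    by (intro differentiableI[OF has_derivative_galerkin_flux]) auto
  show "has_spectrum
             (n $ 1 *\<^sub>R jacobian (\<lambda>w. gpc_flux A 1 w v) (at u)
              + n $ 2 *\<^sub>R jacobian (\<lambda>w. gpc_flux A 2 w v) (at u))
             [eigmat A v ** diag_map inverse (eigmat A (norm_modes A u))
                ** (n $ 1 *\<^sub>R eigmat A (modes u 1) + n $ 2 *\<^sub>R eigmat A (modes u 2)), 0]"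
    unfolding gpc_flux_galerkin_flux[OF A] eigmat_norm_modes[OF A] eigmat_modes[OF A]
      eigmat_cell_value[OF A, of v] diag_map_diag_mat scaleR_diag_mat diag_mat_add diag_mat_mult
    by (simp add: nz jacobian_galerkin_flux normal_flux_jacobian)
      (intro has_spectrum_flux_jacobian A n,
        simp add: sgn_div_norm inner_vec_def sum_2 divide_inverse algebra_simps)
qed

text \<open>Where the inverse does not exist, generalized signs replace the quotient.
  \<open>rel_set\<close> says that each generalized Jacobian has a listed spectrum and each listed
  spectrum is attained. Limits along states with \<open>modes w j = 0\<close> reduce the unit ball
  to the scalar set-valued sign.\<close>

theorem corollary2:
  fixes A :: "'k::{finite,linorder} sqmat"
  assumes "haar_type A"
  shows
    "(\<forall>(u :: real \<Rightarrow> real ^ 2 \<Rightarrow> real ^ (2 \<times> 'k)) (v :: real ^ 2 \<Rightarrow> 'k rvec) t x.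
        conservation_law_at
          (\<lambda>t x. galerkin_projection A (expansion2 A (u t x)))
          (\<lambda>d t x. galerkin_projection A
             (\<lambda>\<xi>. level_set_flux d (expansion2 A (u t x) \<xi>) (expansion A (v x) \<xi>))) t x
        \<longleftrightarrow> conservation_law_at u (\<lambda>d t x. gpc_flux A d (u t x) (v x)) t x)
   \<and> (\<forall>u :: real ^ (2 \<times> 'k).
        eigmat A (norm_modes A u) =
          diag_map sqrt (diag_map (\<lambda>x. x\<^sup>2) (eigmat A (modes u 1))
                         + diag_map (\<lambda>x. x\<^sup>2) (eigmat A (modes u 2))))
   \<and> (\<forall>(n :: real ^ 2) (u :: real ^ (2 \<times> 'k)) (v :: 'k rvec). norm n = 1 \<longrightarrow>
        (invertible (eigmat A (norm_modes A u)) \<longrightarrow>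
           (\<forall>d. (\<lambda>w. gpc_flux A d w v) differentiable at u) \<and>
           has_spectrum
             (n $ 1 *\<^sub>R jacobian (\<lambda>w. gpc_flux A 1 w v) (at u)
              + n $ 2 *\<^sub>R jacobian (\<lambda>w. gpc_flux A 2 w v) (at u))
             [eigmat A v ** diag_map inverse (eigmat A (norm_modes A u))
                ** (n $ 1 *\<^sub>R eigmat A (modes u 1) + n $ 2 *\<^sub>R eigmat A (modes u 2)), 0])
      \<and> (let F = (\<lambda>w. n $ 1 *\<^sub>R gpc_flux A 1 w v + n $ 2 *\<^sub>R gpc_flux A 2 w v) in
           generalized_jacobian UNIV F u \<noteq> {} \<and>
           rel_set has_spectrum (generalized_jacobian UNIV F u)
             {[eigmat A v ** (n $ 1 *\<^sub>R diag_mat (\<lambda>l. G l $ 1) + n $ 2 *\<^sub>R diag_mat (\<lambda>l. G l $ 2)), 0]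
                | G :: 'k \<Rightarrow> real ^ 2.
                  \<forall>l. G l \<in> generalized_sgn (\<chi> d. eigmat A (modes u d) $ l $ l)} \<and>
           (\<forall>i j. j \<noteq> i \<and> modes u j = 0 \<longrightarrow>
              (invertible (eigmat A (modes u i)) \<longrightarrow>
                 (\<forall>M \<in> generalized_jacobian UNIV F u.
                    has_spectrum M [n $ i *\<^sub>R (eigmat A v ** diag_map sgn (eigmat A (modes u i))), 0])) \<and>
              (\<exists>M \<in> generalized_jacobian UNIV F u.
                 has_spectrum M [n $ i *\<^sub>R (eigmat A v ** diag_map sgn (eigmat A (modes u i))), 0]) \<and>
              rel_set has_spectrum (generalized_jacobian {w. modes w j = 0} F u)
                {[n $ i *\<^sub>R (eigmat A v ** diag_mat s), 0]
                   | s. \<forall>l. s l \<in> generalized_sgn (eigmat A (modes u i) $ l $ l)})))"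
proof (intro conjI allI impI)
  note A = assms
  show "conservation_law_at
          (\<lambda>t x. galerkin_projection A (expansion2 A (u t x)))
          (\<lambda>d t x. galerkin_projection A
             (\<lambda>\<xi>. level_set_flux d (expansion2 A (u t x) \<xi>) (expansion A (v x) \<xi>))) t x
        \<longleftrightarrow> conservation_law_at u (\<lambda>d t x. gpc_flux A d (u t x) (v x)) t x" for u v t x
    by (rule gpc_conservation_law[OF A])
  show "eigmat A (norm_modes A u) =
          diag_map sqrt (diag_map (\<lambda>x. x\<^sup>2) (eigmat A (modes u 1))
                         + diag_map (\<lambda>x. x\<^sup>2) (eigmat A (modes u 2)))" for u
    by (rule eigmat_norm_modes_sqrt[OF A])
  fix n :: "real ^ 2" and u :: "real ^ (2 \<times> 'k)" and v :: "'k rvec"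
  assume n: "norm n = 1"
  show "(\<lambda>w. gpc_flux A d w v) differentiable at u" if "invertible (eigmat A (norm_modes A u))" for d
    by (rule gpc_flux_spectrum(1)[OF A n that])
  show "has_spectrum
             (n $ 1 *\<^sub>R jacobian (\<lambda>w. gpc_flux A 1 w v) (at u)
              + n $ 2 *\<^sub>R jacobian (\<lambda>w. gpc_flux A 2 w v) (at u))
             [eigmat A v ** diag_map inverse (eigmat A (norm_modes A u))
                ** (n $ 1 *\<^sub>R eigmat A (modes u 1) + n $ 2 *\<^sub>R eigmat A (modes u 2)), 0]"
    if "invertible (eigmat A (norm_modes A u))"
    by (rule gpc_flux_spectrum(2)[OF A n that])
  define F where "F = (\<lambda>w. n $ 1 *\<^sub>R gpc_flux A 1 w v + n $ 2 *\<^sub>R gpc_flux A 2 w v)"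
  let ?c = "cell_value A v" and ?y = "cell_state A u"
  let ?J = "flux_jacobian A n ?c"
  have F: "F = galerkin_flux A n ?c"
    by (simp add: F_def normal_gpc_flux[OF A] fun_eq_iff)
  have n0: "n \<noteq> 0" using n by auto
  have spec: "has_spectrum (?J G) [diag_mat d, 0 :: 'k sqmat]"
    if "\<And>l. d l = ?c l * (n \<bullet> G l)" for d G
    using has_spectrum_flux_jacobian[OF A n, of d] that by blast
  have full: "generalized_jacobian UNIV F u = ?J ` {G. \<forall>l. G l \<in> generalized_sgn (?y l)}"
    using generalized_jacobian_galerkin_flux[OF A n0 subspace_UNIV, of "axis 1 1" u ?c]
    by (simp add: F)
  \<comment> \<open>At \<open>z = 0\<close> the convention \<open>sgn 0 = 0\<close> selects the
    centre of the ball, so the entrywise sign is always an admissible choice.\<close>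
  have sgn: "sgn z \<in> generalized_sgn z" for z :: "real ^ 2"
    by (simp add: generalized_sgn_def)
  have ne: "generalized_jacobian UNIV F u \<noteq> {}"
    unfolding full by (auto intro!: exI[of _ "\<lambda>l. sgn (?y l)"] sgn)
  have rel: "rel_set has_spectrum (generalized_jacobian UNIV F u)
             {[eigmat A v ** (n $ 1 *\<^sub>R diag_mat (\<lambda>l. G l $ 1) + n $ 2 *\<^sub>R diag_mat (\<lambda>l. G l $ 2)), 0]
                | G :: 'k \<Rightarrow> real ^ 2.
                  \<forall>l. G l \<in> generalized_sgn (\<chi> d. eigmat A (modes u d) $ l $ l)}"
  proof -
    have y: "(\<chi> d. eigmat A (modes u d) $ l $ l) = ?y l" for l
      by (simp add: eigmat_modes[OF A] diag_mat_def vec_eq_iff)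
    have "has_spectrum (?J G)
        [eigmat A v ** (n $ 1 *\<^sub>R diag_mat (\<lambda>l. G l $ 1) + n $ 2 *\<^sub>R diag_mat (\<lambda>l. G l $ 2)), 0]" for G
      unfolding eigmat_cell_value[OF A] scaleR_diag_mat diag_mat_add diag_mat_mult
      by (rule spec) (simp add: inner_vec_def sum_2)
    thus ?thesis unfolding full y rel_set_def by blast
  qed
  have one: "(invertible (eigmat A (modes u i)) \<longrightarrow>
                 (\<forall>M \<in> generalized_jacobian UNIV F u.
                    has_spectrum M [n $ i *\<^sub>R (eigmat A v ** diag_map sgn (eigmat A (modes u i))), 0])) \<and>
              (\<exists>M \<in> generalized_jacobian UNIV F u.
                 has_spectrum M [n $ i *\<^sub>R (eigmat A v ** diag_map sgn (eigmat A (modes u i))), 0]) \<and>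
              rel_set has_spectrum (generalized_jacobian {w. modes w j = 0} F u)
                {[n $ i *\<^sub>R (eigmat A v ** diag_mat s), 0]
                   | s. \<forall>l. s l \<in> generalized_sgn (eigmat A (modes u i) $ l $ l)}"
    if ij: "j \<noteq> i" and uj: "modes u j = 0" for i j
  proof -
    \<comment> \<open>In two dimensions this is the line along axis \<open>i\<close>, and the states
      with \<open>modes w j = 0\<close> are those with all cell states on it.\<close>
    define V where "V = {z :: real ^ 2. z $ j = 0}"
    have V: "subspace V" by (simp add: V_def subspace_def)
    have Vaxis: "z \<in> V \<longleftrightarrow> (\<exists>a. z = a *\<^sub>R axis i 1)" for z
    proof
      assume z: "z \<in> V"
      have "z $ k = (z $ i *\<^sub>R axis i 1) $ k" for k
      proof (cases "k = i")
        case False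
        hence "k = j" using ij exhaust_2 by metis
        thus ?thesis using z ij by (simp add: V_def axis_def)
      qed (simp add: axis_def)
      hence "z = z $ i *\<^sub>R axis i 1" by (intro vec_eq_iff[THEN iffD2] allI)
      thus "\<exists>a. z = a *\<^sub>R axis i 1" by blast
    qed (use ij in \<open>auto simp: V_def axis_def\<close>)
    have naxis: "n \<bullet> axis i 1 = n $ i"
      by (simp add: inner_axis)
    have yV: "?y l \<in> V" for l
      using uj by (simp add: V_def modes_eq_0_iff[OF A])
    obtain y where y: "\<And>l. ?y l = y l *\<^sub>R axis i 1"
      using yV unfolding Vaxis by metis
    have yi: "eigmat A (modes u i) = diag_mat y"
      by (simp add: eigmat_modes[OF A] y)
    have sgny: "sgn (?y l) = sgn (y l) *\<^sub>R axis i 1" for l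
      by (simp add: y sgn_div_norm)
    have gsgn: "a *\<^sub>R axis i 1 \<in> generalized_sgn (?y l) \<longleftrightarrow> a \<in> generalized_sgn (y l)" for a l
      by (simp add: generalized_sgn_def y sgn_div_norm)
    have diag: "n $ i *\<^sub>R (eigmat A v ** diag_mat s) = diag_mat (\<lambda>l. n $ i * (?c l * s l))" for s
      by (simp add: eigmat_cell_value[OF A] diag_mat_mult scaleR_diag_mat)
    have spec': "has_spectrum (?J G) [n $ i *\<^sub>R (eigmat A v ** diag_mat s), 0]"
      if "\<And>l. G l = s l *\<^sub>R axis i 1" for G s
      unfolding diag by (rule spec) (simp add: that naxis)
    have sgnspec: "has_spectrum (?J (\<lambda>l. sgn (?y l)))
        [n $ i *\<^sub>R (eigmat A v ** diag_map sgn (eigmat A (modes u i))), 0]"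
      unfolding yi diag_map_diag_mat by (rule spec') (rule sgny)
    have "\<forall>M \<in> generalized_jacobian UNIV F u.
        has_spectrum M [n $ i *\<^sub>R (eigmat A v ** diag_map sgn (eigmat A (modes u i))), 0]"
      if "invertible (eigmat A (modes u i))"
    proof
      fix M assume "M \<in> generalized_jacobian UNIV F u"
      then obtain G where G: "M = ?J G" "\<And>l. G l \<in> generalized_sgn (?y l)"
        unfolding full by blast
      \<comment> \<open>No cell state vanishes, so each generalized sign is a singleton and
        \<open>G\<close> is determined.\<close>
      have "?y l \<noteq> 0" for l
        using that by (simp add: yi y invertible_diag_mat)
      hence "G = (\<lambda>l. sgn (?y l))"
        using G(2) by (auto simp: generalized_sgn_def fun_eq_iff)
      thus "has_spectrum M [n $ i *\<^sub>R (eigmat A v ** diag_map sgn (eigmat A (modes u i))), 0]"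
        using sgnspec G(1) by simp
    qed
    moreover have "\<exists>M \<in> generalized_jacobian UNIV F u.
        has_spectrum M [n $ i *\<^sub>R (eigmat A v ** diag_map sgn (eigmat A (modes u i))), 0]"
      unfolding full using sgnspec sgn by blast
    moreover have "rel_set has_spectrum (generalized_jacobian {w. modes w j = 0} F u)
                {[n $ i *\<^sub>R (eigmat A v ** diag_mat s), 0]
                   | s. \<forall>l. s l \<in> generalized_sgn (eigmat A (modes u i) $ l $ l)}"
    proof -
      have "axis i 1 \<in> V" using Vaxis by (metis scaleR_one)
      hence "generalized_jacobian {w. modes w j = 0} F u
          = ?J ` {G. \<forall>l. G l \<in> generalized_sgn (?y l) \<inter> V}"
        using generalized_jacobian_galerkin_flux[OF A n0 V _ _ yV, of "axis i 1" ?c]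
        by (simp add: F V_def modes_eq_0_iff[OF A])
      also have "\<dots> = {?J (\<lambda>l. s l *\<^sub>R axis i 1) | s. \<forall>l. s l \<in> generalized_sgn (y l)}"
      proof (intro set_eqI iffI)
        fix M assume "M \<in> ?J ` {G. \<forall>l. G l \<in> generalized_sgn (?y l) \<inter> V}"
        then obtain G where G: "M = ?J G" "\<And>l. G l \<in> generalized_sgn (?y l)" "\<And>l. G l \<in> V"
          by blast
        obtain s where "\<And>l. G l = s l *\<^sub>R axis i 1"
          using G(3) unfolding Vaxis by metis
        hence s: "G = (\<lambda>l. s l *\<^sub>R axis i 1)" by blast
        show "M \<in> {?J (\<lambda>l. s l *\<^sub>R axis i 1) | s. \<forall>l. s l \<in> generalized_sgn (y l)}"
          using G(1,2) unfolding s gsgn by blast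
      next
        fix M assume "M \<in> {?J (\<lambda>l. s l *\<^sub>R axis i 1) | s. \<forall>l. s l \<in> generalized_sgn (y l)}"
        then obtain s where "M = ?J (\<lambda>l. s l *\<^sub>R axis i 1)" "\<forall>l. s l \<in> generalized_sgn (y l)"
          by blast
        thus "M \<in> ?J ` {G. \<forall>l. G l \<in> generalized_sgn (?y l) \<inter> V}"
          using gsgn Vaxis by blast
      qed
      finally have jac: "generalized_jacobian {w. modes w j = 0} F u
          = {?J (\<lambda>l. s l *\<^sub>R axis i 1) | s. \<forall>l. s l \<in> generalized_sgn (y l)}" .
      have yl: "eigmat A (modes u i) $ l $ l = y l" for l
        by (simp add: yi diag_mat_def)
      have "has_spectrum (?J (\<lambda>l. s l *\<^sub>R axis i 1)) [n $ i *\<^sub>R (eigmat A v ** diag_mat s), 0]" for s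
        by (rule spec') (rule refl)
      thus ?thesis unfolding jac yl rel_set_def by blast
    qed
    ultimately show ?thesis by blast
  qed
  show "let F = (\<lambda>w. n $ 1 *\<^sub>R gpc_flux A 1 w v + n $ 2 *\<^sub>R gpc_flux A 2 w v) in
           generalized_jacobian UNIV F u \<noteq> {} \<and>
           rel_set has_spectrum (generalized_jacobian UNIV F u)
             {[eigmat A v ** (n $ 1 *\<^sub>R diag_mat (\<lambda>l. G l $ 1) + n $ 2 *\<^sub>R diag_mat (\<lambda>l. G l $ 2)), 0]
                | G :: 'k \<Rightarrow> real ^ 2.
                  \<forall>l. G l \<in> generalized_sgn (\<chi> d. eigmat A (modes u d) $ l $ l)} \<and>
           (\<forall>i j. j \<noteq> i \<and> modes u j = 0 \<longrightarrow>
              (invertible (eigmat A (modes u i)) \<longrightarrow>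
                 (\<forall>M \<in> generalized_jacobian UNIV F u.
                    has_spectrum M [n $ i *\<^sub>R (eigmat A v ** diag_map sgn (eigmat A (modes u i))), 0])) \<and>
              (\<exists>M \<in> generalized_jacobian UNIV F u.
                 has_spectrum M [n $ i *\<^sub>R (eigmat A v ** diag_map sgn (eigmat A (modes u i))), 0]) \<and>
              rel_set has_spectrum (generalized_jacobian {w. modes w j = 0} F u)
                {[n $ i *\<^sub>R (eigmat A v ** diag_mat s), 0]
                   | s. \<forall>l. s l \<in> generalized_sgn (eigmat A (modes u i) $ l $ l)})"
    using ne rel one unfolding Let_def F_def by blast
qed

end
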